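(* There exists a polynomial-time algorithm for deciding whether the vertex set of a 2T-graph $G=(V,E)$ decomposes into vertex-disjoint generic circuits, i.e. whether $V$ has a partition $V_1,\dots,V_k$ such that each $G[V_i]$ is a generic circuit. Furthermore, if there is such a decomposition, then it is unique.
   Context: Graphs may contain parallel edges but no loops. $G[X]$ is the subgraph of $G$ induced by $X$. A 2T-graph is a graph whose edge set is the union of two edge-disjoint spanning trees. A graph $G=(V,E)$ is a generic circuit if $|E|=2|V|-2>0$ and $|E(G[X])|\le 2|X|-3$ for every $X\subset V$ with $2\le |X|\le |V|-1$. "Polynomial" means polynomial in the size of $G$. *)

theory Defs
  imports
    Main
    "HOL-Library.Disjoint_Sets"
    "HOL-Computational_Algebra.Polynomial"
begin

record ('v, 'e) mgraph =
  verts :: "'v set"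
  edges :: "'e set"
  ends :: "'e \<Rightarrow> 'v set"

definition multigraph :: "('v, 'e) mgraph \<Rightarrow> bool" where
  "multigraph G \<longleftrightarrow> finite (verts G) \<and> finite (edges G) \<and>
     (\<forall>e\<in>edges G. ends G e \<subseteq> verts G \<and> card (ends G e) = 2)"

definition induced :: "('v, 'e) mgraph \<Rightarrow> 'v set \<Rightarrow> ('v, 'e) mgraph" where
  "induced G X = \<lparr>verts = X, edges = {e \<in> edges G. ends G e \<subseteq> X}, ends = ends G\<rparr>"

definition connected_graph :: "('v, 'e) mgraph \<Rightarrow> bool" where
  "connected_graph G \<longleftrightarrow> verts G \<noteq> {} \<and>
     (\<forall>u\<in>verts G. \<forall>v\<in>verts G. (u, v) \<in> {(a, b). \<exists>e\<in>edges G. ends G e = {a, b}}\<^sup>*)"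

text \<open>The edge \<open>es ! i\<close> joins consecutive vertices \<open>vs ! i\<close> and \<open>vs ! (i + 1)\<close>, cyclically;
  two parallel edges form a cycle of length 2.\<close>

definition cycle :: "('v, 'e) mgraph \<Rightarrow> 'v list \<Rightarrow> 'e list \<Rightarrow> bool" where
  "cycle G vs es \<longleftrightarrow> 2 \<le> length vs \<and> length es = length vs \<and> distinct vs \<and> distinct es \<and>
     set es \<subseteq> edges G \<and>
     (\<forall>i<length vs. ends G (es ! i) = {vs ! i, vs ! (Suc i mod length vs)})"

definition tree :: "('v, 'e) mgraph \<Rightarrow> bool" where
  "tree G \<longleftrightarrow> multigraph G \<and> connected_graph G \<and> (\<nexists>vs es. cycle G vs es)"

definition spanning_tree :: "('v, 'e) mgraph \<Rightarrow> 'e set \<Rightarrow> bool" where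
  "spanning_tree G T \<longleftrightarrow> T \<subseteq> edges G \<and> tree (G\<lparr>edges := T\<rparr>)"

definition two_tree_graph :: "('v, 'e) mgraph \<Rightarrow> bool" where
  "two_tree_graph G \<longleftrightarrow> multigraph G \<and>
     (\<exists>S T. spanning_tree G S \<and> spanning_tree G T \<and> S \<inter> T = {} \<and> edges G = S \<union> T)"

definition generic_circuit :: "('v, 'e) mgraph \<Rightarrow> bool" where
  "generic_circuit G \<longleftrightarrow> multigraph G \<and>
     int (card (edges G)) = 2 * int (card (verts G)) - 2 \<and> 0 < card (edges G) \<and>
     (\<forall>X. X \<subset> verts G \<and> 2 \<le> card X \<and> card X \<le> card (verts G) - 1 \<longrightarrow>
        int (card (edges (induced G X))) \<le> 2 * int (card X) - 3)"

definition circuit_decomposition :: "('v, 'e) mgraph \<Rightarrow> 'v set set \<Rightarrow> bool" where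
  "circuit_decomposition G P \<longleftrightarrow>
     partition_on (verts G) P \<and> (\<forall>X\<in>P. generic_circuit (induced G X))"

text \<open>
  The machine is a random access machine in the style of Cook and Reckhow, with registers
  \<open>R 0, R 1, \<dots>\<close> holding natural numbers, and a read-only input that is a finite sequence of
  natural numbers. The operations are constants, addition, truncated subtraction, indirect
  access, and a conditional jump; there is no multiplication, so the bit length of the numbers
  in the registers grows by at most one per step (beyond that of the input and of the program
  constants). Hence counting every instruction as one step yields the same class of
  polynomial-time computations as Turing machines.
\<close>

datatype instr =
    Const nat nat
  | Add nat nat nat
  | Sub nat nat nat
  | Load nat nat
  | Store nat nat
  | Read nat nat
  | Jump_Pos nat nat

fun exec_instr :: "nat list \<Rightarrow> instr \<Rightarrow> nat \<times> (nat \<Rightarrow> nat) \<Rightarrow> nat \<times> (nat \<Rightarrow> nat)" where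
  "exec_instr w (Const i c) (pc, R) = (Suc pc, R(i := c))"
| "exec_instr w (Add i j k) (pc, R) = (Suc pc, R(i := R j + R k))"
| "exec_instr w (Sub i j k) (pc, R) = (Suc pc, R(i := R j - R k))"
| "exec_instr w (Load i j) (pc, R) = (Suc pc, R(i := R (R j)))"
| "exec_instr w (Store i j) (pc, R) = (Suc pc, R(R i := R j))"
| "exec_instr w (Read i j) (pc, R) = (Suc pc, R(i := (if R j < length w then w ! R j else 0)))"
| "exec_instr w (Jump_Pos i l) (pc, R) = (if R i > 0 then l else Suc pc, R)"

text \<open>A configuration whose program counter lies outside the program is halted, and stays
  unchanged.\<close>

definition ram_step ::
    "instr list \<Rightarrow> nat list \<Rightarrow> nat \<times> (nat \<Rightarrow> nat) \<Rightarrow> nat \<times> (nat \<Rightarrow> nat)" where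
  "ram_step M w c = (if fst c < length M then exec_instr w (M ! fst c) c else c)"

text \<open>On input \<open>w\<close>, the program \<open>M\<close> halts after at most \<open>t\<close> steps with the answer \<open>b\<close>, which is
  encoded by whether \<open>R 0\<close> is nonzero. Halted configurations being fixed, inspecting the
  configuration after exactly \<open>t\<close> iterations covers all earlier halting times.\<close>

definition ram_decides :: "instr list \<Rightarrow> nat list \<Rightarrow> nat \<Rightarrow> bool \<Rightarrow> bool" where
  "ram_decides M w t b \<longleftrightarrow>
     (case (ram_step M w ^^ t) (0, \<lambda>_. 0) of (pc, R) \<Rightarrow> length M \<le> pc \<and> (R 0 \<noteq> 0 \<longleftrightarrow> b))"

text \<open>
  The input sequence \<open>w\<close> is an edge-list representation of \<open>G\<close>: the number \<open>n\<close> of vertices, the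
  number of edges, and then, edge by edge, the two end vertices, where the vertices are
  numbered \<open>0, \<dots>, n - 1\<close> by \<open>f\<close>. The numbering \<open>f\<close>, the order \<open>es\<close> of the edges and the order of
  the two ends of an edge are arbitrary.
\<close>

definition graph_code :: "('v, 'e) mgraph \<Rightarrow> nat list \<Rightarrow> bool" where
  "graph_code G w \<longleftrightarrow>
     (\<exists>f es ps. bij_betw f (verts G) {..<card (verts G)} \<and>
        distinct es \<and> set es = edges G \<and>
        list_all2 (\<lambda>e (a, b). f ` ends G e = {a, b}) es ps \<and>
        w = card (verts G) # card (edges G) # concat (map (\<lambda>(a, b). [a, b]) ps))"

end

theory Submission imports Defs begin

text \<open>Write \<open>i(X)\<close> for the number of edges inside a vertex set \<open>X\<close>. A forest has at most
\<open>|X| - 1\<close> edges inside \<open>X\<close>, so in a graph made of two edge-disjoint spanning trees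
\<open>i(X) \<le> 2|X| - 2\<close> for every nonempty \<open>X\<close>, with equality for the whole vertex set. Call \<open>X\<close> tight
if equality holds. The function \<open>i\<close> is supermodular, so two tight sets that meet have a tight
intersection (\<open>tight_Int\<close>), and the generic circuits of the form \<open>G[X]\<close> are exactly those of the
minimal tight sets with at least two vertices, called circuits here. Two distinct circuits share
at most one vertex, hence no edge.

Everything about decompositions rests on one count (\<open>exists_private_vertex\<close>): every nonempty
family of distinct circuits has a member with a vertex that lies in no other member. Otherwise
the family covers every vertex of its union \<open>W\<close> at least twice, and as its members \<open>X\<close> have
pairwise disjoint sets of \<open>2|X| - 2 \<ge> |X|\<close> edges, at least \<open>2|W|\<close> edges lie inside \<open>W\<close>, too
many. Applied to the symmetric difference of two decompositions, this gives uniqueness. Applied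
to a family of circuits that has been cleaned up, it gives a decision procedure: keep deleting a
circuit \<open>C\<close> when some vertex outside \<open>C\<close> is covered only by remaining circuits that meet \<open>C\<close>. No
circuit of a decomposition is ever deleted, and if no deletion is possible and the remaining
circuits cover all vertices, they are pairwise disjoint (\<open>irreducible_decomposition\<close>).

It remains to find the circuits. Every circuit is the least tight set containing the ends \<open>r\<close>,
\<open>s\<close> of any one of its edges. This hull is found by balancing loads. Every edge distributes \<open>M\<close>
units among its two ends, the vertex \<open>r\<close> gets \<open>2M\<close> additional units and \<open>s\<close> gets a smaller
additional amount \<open>D\<close>. While there is an edge whose ends differ in load by at least 2 and which
can move a unit to the less loaded end, it does so; the sum of the squares of the loads
decreases, so there are only polynomially many moves. In the final state consider the vertices
whose load exceeds a value \<open>t \<ge> 2M\<close> that no vertex takes. Edges leaving this set contribute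
nothing to it, so its edges and its extra units alone lift its average above \<open>2M\<close>, and this is
possible only for tight sets containing \<open>r\<close> and \<open>s\<close>; since moreover the excess of any such set
is already contained in the hull, the set is the hull (\<open>balanced_load_thull\<close>). As there are only
\<open>n\<close> vertices, a missing value \<open>t\<close> exists in every range of \<open>n + 1\<close> values, and for \<open>D > 2n\<^sup>2\<close>
the hull turns out to be the set of vertices of load more than \<open>2M + n\<close>.

The procedure consists of nested counting loops whose bodies update arrays. It is therefore
written in a small loop language with a functional semantics, in which a program whose variables
never exceed \<open>B\<close> runs for a number of steps that is bounded by a polynomial in \<open>B\<close> read off its
text. The language is compiled to the random access machine (\<open>com_code_correct\<close>).\<close>

section \<open>Tight sets and circuits\<close>

definition inside :: "('v, 'e) mgraph \<Rightarrow> 'v set \<Rightarrow> 'e set" where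
  "inside G X = {e \<in> edges G. ends G e \<subseteq> X}"

text \<open>The counts that hold in every graph made of two edge-disjoint spanning trees and carry the
whole argument.\<close>

locale sparse_graph =
  fixes G :: "('v, 'e) mgraph"
  assumes multigraph: "multigraph G"
    and verts_nonempty: "verts G \<noteq> {}"
    and sparse: "\<And>X. X \<subseteq> verts G \<Longrightarrow> X \<noteq> {} \<Longrightarrow> card (inside G X) + 2 \<le> 2 * card X"
    and edge_count: "card (edges G) + 2 = 2 * card (verts G)"
begin

definition tight :: "'v set \<Rightarrow> bool" where
  "tight X \<longleftrightarrow> X \<subseteq> verts G \<and> X \<noteq> {} \<and> card (inside G X) + 2 = 2 * card X"

definition circuit :: "'v set \<Rightarrow> bool" where
  "circuit X \<longleftrightarrow> tight X \<and> 2 \<le> card X \<and> (\<forall>Y. tight Y \<and> 2 \<le> card Y \<and> Y \<subseteq> X \<longrightarrow> Y = X)"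

lemma finite_verts: "finite (verts G)" and finite_edges: "finite (edges G)"
  using multigraph by (auto simp: multigraph_def)

lemma finite_inside: "finite (inside G X)"
  using finite_edges by (simp add: inside_def)

lemma ends_verts: "e \<in> edges G \<Longrightarrow> ends G e \<subseteq> verts G"
  and card_ends: "e \<in> edges G \<Longrightarrow> card (ends G e) = 2"
  using multigraph by (auto simp: multigraph_def)

lemma tight_finite: "tight X \<Longrightarrow> finite X"
  using finite_verts finite_subset by (auto simp: tight_def)

lemma inside_verts: "inside G (verts G) = edges G"
  using ends_verts by (auto simp: inside_def)

lemma tight_verts: "tight (verts G)"
  using verts_nonempty edge_count by (simp add: tight_def inside_verts)

text \<open>An edge inside \<open>X\<close> and an edge inside \<open>Y\<close> are both inside \<open>X \<union> Y\<close>, and edges inside both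
sets are inside \<open>X \<inter> Y\<close>, so \<open>i(X) + i(Y) \<le> i(X \<union> Y) + i(X \<inter> Y)\<close>. The two upper bounds on the
right add up to the value on the left, so both are attained.\<close>

lemma tight_Int:
  assumes X: "tight X" and Y: "tight Y" and ne: "X \<inter> Y \<noteq> {}"
  shows "tight (X \<inter> Y)"
proof -
  have fin: "finite X" "finite Y" using X Y tight_finite by auto
  have sub: "X \<subseteq> verts G" "Y \<subseteq> verts G" using X Y by (auto simp: tight_def)
  have "inside G X \<inter> inside G Y = inside G (X \<inter> Y)" by (auto simp: inside_def)
  moreover have "inside G X \<union> inside G Y \<subseteq> inside G (X \<union> Y)" by (auto simp: inside_def)
  then have "card (inside G X \<union> inside G Y) \<le> card (inside G (X \<union> Y))"
    by (rule card_mono[OF finite_inside])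
  ultimately have "card (inside G X) + card (inside G Y)
      \<le> card (inside G (X \<union> Y)) + card (inside G (X \<inter> Y))"
    using card_Un_Int[OF finite_inside[of X] finite_inside[of Y]] by simp
  moreover have "card (inside G (X \<union> Y)) + 2 \<le> 2 * card (X \<union> Y)"
    using sub ne by (intro sparse) auto
  moreover have "card (inside G (X \<inter> Y)) + 2 \<le> 2 * card (X \<inter> Y)"
    using sub ne by (intro sparse) auto
  moreover have "card X + card Y = card (X \<union> Y) + card (X \<inter> Y)"
    using fin by (rule card_Un_Int)
  ultimately have "card (inside G (X \<inter> Y)) + 2 = 2 * card (X \<inter> Y)"
    using X Y by (simp add: tight_def)
  then show ?thesis using sub ne by (auto simp: tight_def)
qed

text \<open>A larger intersection would be a tight set that contradicts the minimality of one of the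
two.\<close>

lemma circuits_meet:
  assumes "circuit X" "circuit Y" "X \<noteq> Y"
  shows "card (X \<inter> Y) \<le> 1"
proof (rule ccontr)
  assume "\<not> ?thesis"
  then have "2 \<le> card (X \<inter> Y)" by simp
  moreover from this have "tight (X \<inter> Y)"
    using assms by (intro tight_Int) (auto simp: circuit_def)
  ultimately show False using assms unfolding circuit_def by (metis inf_le1 inf_le2)
qed

lemma circuit_finite: "circuit X \<Longrightarrow> finite X"
  using tight_finite by (auto simp: circuit_def)

lemma circuits_edge_disjoint:
  assumes "circuit X" "circuit Y" "X \<noteq> Y"
  shows "inside G X \<inter> inside G Y = {}"
proof (rule ccontr)
  assume "\<not> ?thesis"
  then obtain e where "e \<in> edges G" "ends G e \<subseteq> X \<inter> Y" by (auto simp: inside_def)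
  then have "2 \<le> card (X \<inter> Y)"
    using card_ends[of e] card_mono[of "X \<inter> Y" "ends G e"] assms circuit_finite by auto
  then show False using circuits_meet[OF assms] by simp
qed

text \<open>The family of circuits behaves like a hyperforest, and a private vertex is one of its
leaves. Circuits have disjoint edge sets and at least as many edges as vertices; covering every
vertex of the union twice would thus force twice as many edges as vertices inside the union.\<close>

lemma exists_private_vertex:
  assumes F: "\<And>X. X \<in> F \<Longrightarrow> circuit X" and ne: "F \<noteq> {}"
  shows "\<exists>X\<in>F. \<exists>v\<in>X. \<forall>Y\<in>F. v \<in> Y \<longrightarrow> Y = X"
proof (rule ccontr)
  assume neg: "\<not> ?thesis"
  let ?W = "\<Union>F"
  have W: "?W \<subseteq> verts G" using F by (auto simp: circuit_def tight_def)
  then have finW: "finite ?W" using finite_verts finite_subset by blast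
  then have finF: "finite F" by (rule finite_UnionD)
  have two: "2 \<le> card {X \<in> F. v \<in> X}" if v: "v \<in> ?W" for v
  proof -
    obtain X where X: "X \<in> F" "v \<in> X" using v by auto
    then have "\<not> (\<forall>Y\<in>F. v \<in> Y \<longrightarrow> Y = X)" using neg by metis
    then obtain Y where "Y \<in> F" "v \<in> Y" "X \<noteq> Y" by auto
    with X have "card {X, Y} \<le> card {X \<in> F. v \<in> X}" using finF by (intro card_mono) auto
    then show ?thesis using \<open>X \<noteq> Y\<close> by simp
  qed
  have "(\<Sum>X\<in>F. card X) = (\<Sum>X\<in>F. \<Sum>v\<in>?W. if v \<in> X then 1 else 0)"
  proof (rule sum.cong)
    fix X assume X: "X \<in> F"
    then have "?W \<inter> X = X" by auto
    then show "card X = (\<Sum>v\<in>?W. if v \<in> X then 1 else 0)"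
      using finW by (simp add: sum.If_cases)
  qed simp
  also have "\<dots> = (\<Sum>v\<in>?W. \<Sum>X\<in>F. if v \<in> X then 1 else 0)" by (rule sum.swap)
  also have "\<dots> = (\<Sum>v\<in>?W. card {X \<in> F. v \<in> X})"
    using finF by (simp add: sum.If_cases Collect_conj_eq)
  also have "\<dots> \<ge> (\<Sum>v\<in>?W. 2)" using two by (intro sum_mono)
  finally have incidences: "2 * card ?W \<le> (\<Sum>X\<in>F. card X)" by simp
  have "card (\<Union>X\<in>F. inside G X) = (\<Sum>X\<in>F. card (inside G X))"
    using finF finite_inside circuits_edge_disjoint F by (intro card_UN_disjoint) auto
  moreover have "card (\<Union>X\<in>F. inside G X) \<le> card (inside G ?W)"
    by (rule card_mono[OF finite_inside]) (auto simp: inside_def)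
  moreover have "?W \<noteq> {}" using ne F by (auto simp: circuit_def tight_def)
  then have "card (inside G ?W) + 2 \<le> 2 * card ?W" using W by (rule sparse[rotated])
  ultimately have "(\<Sum>X\<in>F. card (inside G X)) + 2 \<le> 2 * card ?W" by simp
  moreover have "(\<Sum>X\<in>F. card X) \<le> (\<Sum>X\<in>F. card (inside G X))"
    using F by (intro sum_mono) (fastforce simp: circuit_def tight_def)
  ultimately show False using incidences by simp
qed

text \<open>Sparsity forces \<open>i(Y) \<le> 2|Y| - 2\<close>, so the bound \<open>2|Y| - 3\<close> for proper subsets says that
none of them is tight.\<close>

lemma generic_circuit_induced:
  assumes X: "X \<subseteq> verts G"
  shows "generic_circuit (induced G X) \<longleftrightarrow> circuit X"
proof -
  have finX: "finite X" using X finite_verts finite_subset by blast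
  have mg: "multigraph (induced G X)"
    using finite_edges card_ends finX by (auto simp: multigraph_def induced_def)
  have ed: "edges (induced G X) = inside G X" by (simp add: induced_def inside_def)
  have ed2: "edges (induced (induced G X) Y) = inside G Y" if "Y \<subseteq> X" for Y
    using that by (auto simp: induced_def inside_def)
  have ve: "verts (induced G X) = X" by (simp add: induced_def)
  show ?thesis
  proof
    assume g: "generic_circuit (induced G X)"
    have c: "card (inside G X) + 2 = 2 * card X" "2 \<le> card X"
      using g unfolding generic_circuit_def ed ve by linarith+
    have "Y = X" if Y: "tight Y" "2 \<le> card Y" "Y \<subseteq> X" for Y
    proof (rule ccontr)
      assume "Y \<noteq> X"
      then have YX: "Y \<subset> X" using Y by auto
      have "card Y \<le> card X - 1" using psubset_card_mono[OF finX YX] by linarith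
      with YX have "int (card (edges (induced (induced G X) Y))) \<le> 2 * int (card Y) - 3"
        using g Y(2) unfolding generic_circuit_def ve by blast
      then have "int (card (inside G Y)) \<le> 2 * int (card Y) - 3" using ed2[OF Y(3)] by simp
      then show False using Y by (simp add: tight_def)
    qed
    moreover have "tight X" using c X by (auto simp: tight_def)
    ultimately show "circuit X" using c by (auto simp: circuit_def)
  next
    assume c: "circuit X"
    have "int (card (inside G Y)) \<le> 2 * int (card Y) - 3" if Y: "Y \<subset> X" "2 \<le> card Y" for Y
    proof -
      have "Y \<subseteq> verts G" "Y \<noteq> {}" using Y X by auto
      moreover have "\<not> tight Y" using c Y by (auto simp: circuit_def)
      ultimately show ?thesis using sparse[of Y] by (simp add: tight_def)
    qed
    moreover have "card (inside G X) + 2 = 2 * card X" "2 \<le> card X"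
      using c by (auto simp: circuit_def tight_def)
    ultimately show "generic_circuit (induced G X)"
      using mg ed2 unfolding generic_circuit_def ed ve by (auto simp: psubset_imp_subset)
  qed
qed

lemma circuit_decomposition_iff:
  "circuit_decomposition G P \<longleftrightarrow> partition_on (verts G) P \<and> (\<forall>X\<in>P. circuit X)"
  unfolding circuit_decomposition_def
  using generic_circuit_induced by (metis Union_upper partition_onD1)

text \<open>Each vertex lies in exactly one block of either decomposition. Hence a vertex of a block
that only one decomposition contains lies in a second such block, on the other side, and the
symmetric difference has no private vertex.\<close>

lemma decomposition_unique:
  assumes P: "circuit_decomposition G P" and Q: "circuit_decomposition G Q"
  shows "P = Q"
proof (rule ccontr)
  assume "P \<noteq> Q"
  let ?F = "(P - Q) \<union> (Q - P)"
  have part: "partition_on (verts G) P" "partition_on (verts G) Q"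
    and circ: "\<And>X. X \<in> ?F \<Longrightarrow> circuit X"
    using P Q by (auto simp: circuit_decomposition_iff)
  have sym: False if "X \<in> A - B" "v \<in> X" "\<forall>Y\<in>(A - B) \<union> (B - A). v \<in> Y \<longrightarrow> Y = X"
    "partition_on (verts G) A" "partition_on (verts G) B" for X v A B
  proof -
    have "v \<in> verts G" using that by (auto simp: partition_on_def)
    then have "v \<in> \<Union>B" using partition_onD1[OF that(5)] by simp
    then obtain Y where Y: "Y \<in> B" "v \<in> Y" by auto
    then show False using that
      by (metis DiffD1 DiffD2 DiffI UnI2 disjointD disjoint_iff partition_onD2)
  qed
  have "?F \<noteq> {}" using \<open>P \<noteq> Q\<close> by auto
  then obtain X v where X: "X \<in> ?F" "v \<in> X" "\<forall>Y\<in>?F. v \<in> Y \<longrightarrow> Y = X"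
    using exists_private_vertex[of ?F] circ by blast
  from X(1) show False
  proof
    assume "X \<in> P - Q" then show False using sym[of X P Q v] X part by blast
  next
    assume "X \<in> Q - P" then show False using sym[of X Q P v] X part by blast
  qed
qed

end

section \<open>Graphs with two edge-disjoint spanning trees\<close>

definition path :: "('v, 'e) mgraph \<Rightarrow> 'v list \<Rightarrow> 'e list \<Rightarrow> bool" where
  "path G vs es \<longleftrightarrow> length vs = Suc (length es) \<and> distinct vs \<and> set es \<subseteq> edges G \<and>
     (\<forall>i<length es. ends G (es ! i) = {vs ! i, vs ! Suc i})"

lemma path_distinct_edges:
  assumes p: "path G vs es" shows "distinct es"
  unfolding distinct_conv_nth
proof (intro allI impI)
  fix i j assume ij: "i < length es" "j < length es" "i \<noteq> j"
  have len: "length vs = Suc (length es)" and d: "distinct vs"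
    and e: "\<And>i. i < length es \<Longrightarrow> ends G (es ! i) = {vs ! i, vs ! Suc i}"
    using p by (auto simp: path_def)
  have neq: "vs ! i \<noteq> vs ! j" "vs ! Suc i \<noteq> vs ! Suc j"
    using ij len d by (auto simp: nth_eq_iff_index_eq)
  show "es ! i \<noteq> es ! j"
  proof
    assume "es ! i = es ! j"
    then have "{vs ! i, vs ! Suc i} = {vs ! j, vs ! Suc j}" using e ij by metis
    then have "vs ! i = vs ! Suc j" "vs ! Suc i = vs ! j"
      using neq by (auto simp: doubleton_eq_iff)
    then have "i = Suc j" "Suc i = j" using ij len d by (auto simp: nth_eq_iff_index_eq)
    then show False by simp
  qed
qed

text \<open>Extend a longest path at its first vertex: if that vertex had a second edge, its other end
would either prolong the path or close a cycle with an initial segment of it.\<close>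

lemma acyclic_has_leaf:
  assumes mg: "multigraph G" and ac: "\<nexists>vs es. cycle G vs es" and ne: "verts G \<noteq> {}"
  shows "\<exists>v\<in>verts G. card {e \<in> edges G. v \<in> ends G e} \<le> 1"
proof (rule ccontr)
  assume neg: "\<not> ?thesis"
  have fin: "finite (verts G)" "finite (edges G)" using mg by (auto simp: multigraph_def)
  define Q where "Q k \<longleftrightarrow> (\<exists>vs es. path G vs es \<and> set vs \<subseteq> verts G \<and> length vs = k)" for k
  obtain v where "v \<in> verts G" using ne by auto
  then have "Q 1"
    unfolding Q_def path_def by (intro exI[of _ "[v]"] exI[of _ "[]"]) auto
  moreover have "k \<le> card (verts G)" if "Q k" for k
    using that fin unfolding Q_def path_def by (metis card_mono distinct_card)
  ultimately obtain k where Qk: "Q k" and max: "\<And>j. Q j \<Longrightarrow> j \<le> k"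
    by (metis Greatest_le_nat GreatestI_nat)
  then obtain vs es where p: "path G vs es" and sub: "set vs \<subseteq> verts G" and k: "length vs = k"
    by (auto simp: Q_def)
  have len: "length vs = Suc (length es)" and d: "distinct vs" and se: "set es \<subseteq> edges G"
    and en: "\<And>i. i < length es \<Longrightarrow> ends G (es ! i) = {vs ! i, vs ! Suc i}"
    using p by (auto simp: path_def)
  let ?D = "{e \<in> edges G. vs ! 0 \<in> ends G e}"
  have "2 \<le> card ?D" using neg sub len by (metis not_less_eq_eq nth_mem numeral_2_eq_2
        One_nat_def subsetD zero_less_Suc)
  then have "\<not> ?D \<subseteq> {es ! 0}" using card_mono[of "{es ! 0}" ?D] by auto
  then obtain e where e: "e \<in> edges G" "vs ! 0 \<in> ends G e" "e \<noteq> es ! 0" by auto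
  then have "card (ends G e) = 2" "ends G e \<subseteq> verts G" using mg by (auto simp: multigraph_def)
  then obtain w where w: "ends G e = {vs ! 0, w}" "w \<noteq> vs ! 0" "w \<in> verts G"
    using e by (auto simp: card_2_iff doubleton_eq_iff)
  show False
  proof (cases "w \<in> set vs")
    case False
    have "path G (w # vs) (e # es)"
      using False len d se e w en by (auto simp: path_def nth_Cons split: nat.splits)
    then have "Q (Suc k)" using w sub k unfolding Q_def
      by (intro exI[of _ "w # vs"] exI[of _ "e # es"]) auto
    then show False using max by fastforce
  next
    case True
    then obtain j where j: "j < length vs" "w = vs ! j" by (auto simp: in_set_conv_nth)
    then have j0: "j \<noteq> 0" using w(2) by (metis j(2))
    have notin: "e \<noteq> es ! i" if "i < j" for i
    proof
      assume eq: "e = es ! i"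
      then have "i \<noteq> 0" using e by metis
      moreover have "vs ! 0 \<in> {vs ! i, vs ! Suc i}" using en[of i] eq w that j len by auto
      ultimately show False using d that j len by (auto simp: nth_eq_iff_index_eq)
    qed
    let ?vs = "take (Suc j) vs" and ?es = "take j es @ [e]"
    have "cycle G ?vs ?es"
      unfolding cycle_def
    proof (intro conjI allI impI)
      show "2 \<le> length ?vs" using j j0 by simp
      show "length ?es = length ?vs" using j len by simp
      show "distinct ?vs" using d by (rule distinct_take)
      have "e \<notin> set (take j es)" using notin j len by (auto simp: in_set_conv_nth)
      then show "distinct ?es" using path_distinct_edges[OF p] by simp
      show "set ?es \<subseteq> edges G" using se e set_take_subset[of j es] by auto
      fix i assume i: "i < length ?vs"
      show "ends G (?es ! i) = {?vs ! i, ?vs ! (Suc i mod length ?vs)}"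
      proof (cases "i = j")
        case True
        then show ?thesis using j w len by (auto simp: nth_append insert_commute)
      next
        case False
        then have "i < j" using i j by simp
        then show ?thesis using j len en[of i] by (simp add: nth_append)
      qed
    qed
    then show False using ac by blast
  qed
qed

lemma acyclic_edges_le:
  assumes "multigraph G" "\<nexists>vs es. cycle G vs es" "verts G \<noteq> {}"
  shows "card (edges G) + 1 \<le> card (verts G)"
  using assms
proof (induction "card (verts G)" arbitrary: G)
  case 0
  then show ?case by (simp add: multigraph_def)
next
  case (Suc n)
  have fin: "finite (verts G)" "finite (edges G)" using Suc by (auto simp: multigraph_def)
  obtain v where v: "v \<in> verts G" "card {e \<in> edges G. v \<in> ends G e} \<le> 1"
    using acyclic_has_leaf Suc by blast
  let ?D = "{e \<in> edges G. v \<in> ends G e}"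
  show ?case
  proof (cases "verts G = {v}")
    case True
    have "False" if "e \<in> edges G" for e
    proof -
      have "card (ends G e) = 2" "ends G e \<subseteq> {v}"
        using Suc.prems(1) that True by (auto simp: multigraph_def)
      then show False using card_mono[of "{v}" "ends G e"] by simp
    qed
    then have "edges G = {}" by auto
    then show ?thesis using True by simp
  next
    case False
    let ?H = "G\<lparr>verts := verts G - {v}, edges := edges G - ?D\<rparr>"
    have "cycle G vs es" if "cycle ?H vs es" for vs es
      using that by (auto simp: cycle_def)
    then have "card (edges ?H) + 1 \<le> card (verts ?H)"
      using Suc v False by (intro Suc.hyps(1)) (auto simp: multigraph_def)
    moreover have "card (edges G - ?D) = card (edges G) - card ?D"
      using fin by (intro card_Diff_subset) auto
    ultimately show ?thesis using v fin by (simp add: card_Diff_singleton)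
  qed
qed

text \<open>A largest vertex set with at least \<open>|X| - 1\<close> edges inside is the whole vertex set, because
by connectedness some edge leaves any smaller set, and its outer end can be added together with
it.\<close>

lemma connected_edges_ge:
  assumes mg: "multigraph G" and con: "connected_graph G"
  shows "card (verts G) \<le> card (edges G) + 1"
proof -
  have fin: "finite (verts G)" "finite (edges G)" using mg by (auto simp: multigraph_def)
  define Q where "Q k \<longleftrightarrow> (\<exists>X\<subseteq>verts G. card X = k \<and> X \<noteq> {} \<and> card X \<le> card (inside G X) + 1)" for k
  obtain v where "v \<in> verts G" using con by (auto simp: connected_graph_def)
  then have "Q 1" by (auto simp: Q_def intro!: exI[of _ "{v}"])
  moreover have "k \<le> card (verts G)" if "Q k" for k
    using that fin by (auto simp: Q_def intro: card_mono)
  ultimately obtain k where Qk: "Q k" and max: "\<And>j. Q j \<Longrightarrow> j \<le> k"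
    by (metis Greatest_le_nat GreatestI_nat)
  then obtain X where X: "X \<subseteq> verts G" "card X = k" "X \<noteq> {}" "card X \<le> card (inside G X) + 1"
    by (auto simp: Q_def)
  have finX: "finite X" using X fin finite_subset by auto
  have "X = verts G"
  proof (rule ccontr)
    assume "X \<noteq> verts G"
    then obtain u z where u: "u \<in> X" and z: "z \<in> verts G" "z \<notin> X" using X by auto
    let ?r = "{(a, b). \<exists>e\<in>edges G. ends G e = {a, b}}"
    have "(u, z) \<in> ?r\<^sup>*" using con u z X by (auto simp: connected_graph_def)
    moreover have "b \<in> X" if "(u, b) \<in> ?r\<^sup>*" "\<And>a b. (a, b) \<in> ?r \<Longrightarrow> a \<in> X \<Longrightarrow> b \<in> X" for b
      using that by (induction rule: rtrancl_induct) (use u in blast)+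
    ultimately obtain a b e where ab: "a \<in> X" "b \<notin> X" "e \<in> edges G" "ends G e = {a, b}"
      using z by blast
    then have b: "b \<in> verts G" using mg by (auto simp: multigraph_def)
    have "insert e (inside G X) \<subseteq> inside G (insert b X)" using ab by (auto simp: inside_def)
    moreover have "finite (inside G (insert b X))" using fin by (simp add: inside_def)
    ultimately have "card (insert e (inside G X)) \<le> card (inside G (insert b X))"
      by (intro card_mono)
    moreover have "e \<notin> inside G X" using ab by (auto simp: inside_def)
    moreover have "finite (inside G X)" using fin by (simp add: inside_def)
    ultimately have "Q (Suc k)"
      using X ab b finX unfolding Q_def by (intro exI[of _ "insert b X"]) auto
    then show False using max by fastforce
  qed
  then have "inside G X = edges G" using mg by (auto simp: inside_def multigraph_def)
  then show ?thesis using X \<open>X = verts G\<close> by simp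
qed

lemma tree_inside:
  assumes T: "spanning_tree G T" and X: "X \<subseteq> verts G" "X \<noteq> {}"
  shows "card (inside G X \<inter> T) + 1 \<le> card X"
proof -
  let ?H = "\<lparr>verts = X, edges = inside G X \<inter> T, ends = ends G\<rparr>"
  have t: "T \<subseteq> edges G" "multigraph (G\<lparr>edges := T\<rparr>)" "\<nexists>vs es. cycle (G\<lparr>edges := T\<rparr>) vs es"
    using T by (auto simp: spanning_tree_def tree_def)
  have "finite X" using t X by (auto simp: multigraph_def intro: finite_subset)
  then have "multigraph ?H" using t by (auto simp: multigraph_def inside_def)
  moreover have "\<nexists>vs es. cycle ?H vs es" using t by (auto simp: cycle_def)
  ultimately show ?thesis using acyclic_edges_le[of ?H] X by simp
qed

text \<open>The upper bounds come from acyclicity of the two trees, the number of all edges from their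
connectedness.\<close>

lemma two_tree_sparse:
  assumes "two_tree_graph G" shows "sparse_graph G"
proof -
  obtain S T where mg: "multigraph G" and S: "spanning_tree G S" and T: "spanning_tree G T"
    and ST: "S \<inter> T = {}" "edges G = S \<union> T" using assms by (auto simp: two_tree_graph_def)
  have fin: "finite (verts G)" "finite (edges G)" using mg by (auto simp: multigraph_def)
  have split: "card (inside G X) = card (inside G X \<inter> S) + card (inside G X \<inter> T)" for X
    using ST fin by (subst card_Un_disjoint[symmetric]) (auto simp: inside_def intro: arg_cong[where f=card])
  have up: "card (inside G X) + 2 \<le> 2 * card X" if "X \<subseteq> verts G" "X \<noteq> {}" for X
    using split[of X] tree_inside[OF S that] tree_inside[OF T that] by simp
  have ne: "verts G \<noteq> {}" using S by (auto simp: spanning_tree_def tree_def connected_graph_def)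
  have all: "inside G (verts G) = edges G" using mg by (auto simp: inside_def multigraph_def)
  have low: "card (verts G) \<le> card U + 1" if "spanning_tree G U" for U
    using that connected_edges_ge[of "G\<lparr>edges := U\<rparr>"]
    by (auto simp: spanning_tree_def tree_def)
  have "card (edges G) = card S + card T" using ST fin by (simp add: card_Un_disjoint)
  then have "card (edges G) + 2 = 2 * card (verts G)"
    using up[of "verts G"] ne all low[OF S] low[OF T] by simp
  then show ?thesis using mg ne up by unfold_locales auto
qed

lemma two_tree_decomposition_unique:
  assumes "two_tree_graph G" "circuit_decomposition G P"
  shows "\<exists>!P. circuit_decomposition G P"
proof -
  interpret sparse_graph G using assms by (intro two_tree_sparse)
  show ?thesis using decomposition_unique assms(2) by blast
qed

section \<open>Finding a decomposition by elimination\<close>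

context sparse_graph
begin

definition thull :: "'v set \<Rightarrow> 'v set" where
  "thull X = \<Inter>{Y. tight Y \<and> X \<subseteq> Y}"

lemma thull_least: "tight Y \<Longrightarrow> X \<subseteq> Y \<Longrightarrow> thull X \<subseteq> Y"
  and thull_superset: "X \<subseteq> thull X"
  by (auto simp: thull_def)

text \<open>All tight supersets of \<open>X\<close> meet in \<open>X\<close>, so they are closed under intersection, and one of
least size is contained in all of them.\<close>

lemma tight_thull:
  assumes X: "X \<noteq> {}" "X \<subseteq> verts G"
  shows "tight (thull X)"
proof -
  let ?P = "\<lambda>Y. tight Y \<and> X \<subseteq> Y"
  have "?P (verts G)" using tight_verts X by simp
  then obtain T where T: "?P T" and min: "\<And>Y. ?P Y \<Longrightarrow> card T \<le> card Y"
    using ex_has_least_nat[of ?P "verts G" card] by blast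
  have "T \<subseteq> Y" if Y: "?P Y" for Y
  proof -
    have "T \<inter> Y \<noteq> {}" using X T Y by blast
    then have "?P (T \<inter> Y)" using T Y tight_Int by blast
    then have "card T \<le> card (T \<inter> Y)" by (rule min)
    then have "T \<inter> Y = T" using T tight_finite by (intro card_seteq) auto
    then show ?thesis by blast
  qed
  then have "thull X = T" using T by (auto simp: thull_def)
  then show ?thesis using T by simp
qed

lemma thull_edge:
  assumes "e \<in> edges G"
  shows "tight (thull (ends G e))" and "ends G e \<subseteq> thull (ends G e)" and "thull (ends G e) \<subseteq> verts G"
    and "2 \<le> card (thull (ends G e))"
proof -
  have "ends G e \<noteq> {}" using card_ends[OF assms] by auto
  then show t: "tight (thull (ends G e))" using ends_verts[OF assms] by (intro tight_thull) auto
  show "ends G e \<subseteq> thull (ends G e)" by (rule thull_superset)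
  then show "2 \<le> card (thull (ends G e))"
    using card_mono[OF tight_finite[OF t]] card_ends[OF assms] by metis
  show "thull (ends G e) \<subseteq> verts G" using t by (simp add: tight_def)
qed

text \<open>The hull of an edge inside \<open>X\<close> is a tight subset of \<open>X\<close> with at least two vertices.\<close>

lemma circuit_eq_hull:
  assumes X: "circuit X" and e: "e \<in> edges G" "ends G e \<subseteq> X"
  shows "thull (ends G e) = X"
  using X thull_edge[OF e(1)] thull_least[of X "ends G e"] e by (auto simp: circuit_def)

lemma tight_has_edge:
  assumes "tight X" "2 \<le> card X"
  shows "\<exists>e\<in>edges G. ends G e \<subseteq> X"
proof -
  have "card (inside G X) \<noteq> 0" using assms by (simp add: tight_def)
  then have "inside G X \<noteq> {}" by auto
  then show ?thesis by (auto simp: inside_def)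
qed

text \<open>A tight set with at least two vertices contains an edge, and the hull of that edge.
Comparing the hulls of edges thus suffices to recognise the minimal ones.\<close>

lemma circuit_hull_iff:
  assumes e: "e \<in> edges G"
  shows "circuit (thull (ends G e)) \<longleftrightarrow>
    (\<forall>f\<in>edges G. ends G f \<subseteq> thull (ends G e) \<longrightarrow> thull (ends G e) \<subseteq> thull (ends G f))"
proof
  assume "circuit (thull (ends G e))"
  then show "\<forall>f\<in>edges G. ends G f \<subseteq> thull (ends G e) \<longrightarrow> thull (ends G e) \<subseteq> thull (ends G f)"
    using circuit_eq_hull by blast
next
  assume min: "\<forall>f\<in>edges G. ends G f \<subseteq> thull (ends G e) \<longrightarrow> thull (ends G e) \<subseteq> thull (ends G f)"
  have "Y = thull (ends G e)" if Y: "tight Y" "2 \<le> card Y" "Y \<subseteq> thull (ends G e)" for Y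
  proof -
    obtain f where f: "f \<in> edges G" "ends G f \<subseteq> Y" using tight_has_edge Y by blast
    then have "thull (ends G e) \<subseteq> thull (ends G f)" using min Y by blast
    then show ?thesis using thull_least[of Y "ends G f"] f Y by blast
  qed
  then show "circuit (thull (ends G e))" using thull_edge[OF e] by (auto simp: circuit_def)
qed

text \<open>Circuits are represented by edges \<open>e\<close>, through the hulls of their ends, and several edges
may stand for the same circuit. Choosing the circuit of a removable edge would leave the vertex
\<open>v\<close> uncovered.\<close>

definition removable :: "'e set \<Rightarrow> 'e \<Rightarrow> bool" where
  "removable A e \<longleftrightarrow> (\<exists>v\<in>verts G. v \<notin> thull (ends G e) \<and>
     (\<forall>f\<in>A. v \<in> thull (ends G f) \<longrightarrow> thull (ends G f) \<inter> thull (ends G e) \<noteq> {}))"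

text \<open>The block that contains \<open>v\<close> is a circuit, hence the hull of an edge of \<open>A\<close>; it is not the
hull of \<open>e\<close>, so the two would be disjoint blocks.\<close>

lemma removable_not_in_decomposition:
  assumes P: "circuit_decomposition G P"
    and A: "\<And>f. f \<in> edges G \<Longrightarrow> thull (ends G f) \<in> P \<Longrightarrow> f \<in> A"
    and rem: "removable A e"
  shows "thull (ends G e) \<notin> P"
proof
  assume e: "thull (ends G e) \<in> P"
  have part: "partition_on (verts G) P" and circ: "\<And>X. X \<in> P \<Longrightarrow> circuit X"
    using P by (auto simp: circuit_decomposition_iff)
  obtain v where v: "v \<in> verts G" "v \<notin> thull (ends G e)"
    and meet: "\<And>f. f \<in> A \<Longrightarrow> v \<in> thull (ends G f) \<Longrightarrow> thull (ends G f) \<inter> thull (ends G e) \<noteq> {}"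
    using rem by (auto simp: removable_def)
  have "v \<in> \<Union>P" using v partition_onD1[OF part] by simp
  then obtain Y where Y: "Y \<in> P" "v \<in> Y" by auto
  obtain f where f: "f \<in> edges G" "thull (ends G f) = Y"
    using circ[OF Y(1)] tight_has_edge[of Y] circuit_eq_hull by (metis circuit_def)
  then have "Y \<inter> thull (ends G e) \<noteq> {}" using A meet Y by metis
  moreover have "Y \<noteq> thull (ends G e)" using Y v by auto
  ultimately show False using partition_onD2[OF part] Y e by (auto simp: disjoint_def)
qed

text \<open>Suppose that some remaining circuits meet others. Among the circuits that do, one, \<open>X\<close>,
has a private vertex \<open>v\<close>, and no remaining circuit other than \<open>X\<close> contains \<open>v\<close> at all, as it
would meet \<open>X\<close>. Then any \<open>Y \<noteq> X\<close> that meets \<open>X\<close> is removable because of \<open>v\<close>.\<close>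

lemma irreducible_decomposition:
  assumes circ: "\<And>e. e \<in> A \<Longrightarrow> circuit (thull (ends G e))"
    and stable: "\<And>e. e \<in> A \<Longrightarrow> \<not> removable A e"
    and cover: "\<And>v. v \<in> verts G \<Longrightarrow> \<exists>e\<in>A. v \<in> thull (ends G e)"
  shows "circuit_decomposition G ((\<lambda>e. thull (ends G e)) ` A)"
proof -
  let ?F = "(\<lambda>e. thull (ends G e)) ` A"
  have F: "circuit X" if "X \<in> ?F" for X using that circ by auto
  define C where "C = {X \<in> ?F. \<exists>Y\<in>?F. Y \<noteq> X \<and> X \<inter> Y \<noteq> {}}"
  have C: "X \<in> C \<longleftrightarrow> X \<in> ?F \<and> (\<exists>Y\<in>?F. Y \<noteq> X \<and> X \<inter> Y \<noteq> {})" for X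
    unfolding C_def by (rule mem_Collect_eq)
  have disj: "C = {}"
  proof (rule ccontr)
    assume "C \<noteq> {}"
    moreover have "circuit X" if "X \<in> C" for X using that C F by metis
    ultimately obtain X v where X: "X \<in> C" "v \<in> X" and priv: "\<forall>Y\<in>C. v \<in> Y \<longrightarrow> Y = X"
      using exists_private_vertex[of C] by metis
    have priv': "Y = X" if Y: "Y \<in> ?F" "v \<in> Y" for Y
    proof (rule ccontr)
      assume "Y \<noteq> X"
      moreover have "v \<in> Y \<inter> X" using Y X by simp
      ultimately have "Y \<in> C" using Y(1) X(1) C by (metis empty_iff)
      then show False using priv Y \<open>Y \<noteq> X\<close> by simp
    qed
    obtain Y where Y: "Y \<in> ?F" "Y \<noteq> X" "X \<inter> Y \<noteq> {}" using X(1) C by metis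
    from Y(1) obtain e where e: "e \<in> A" "Y = thull (ends G e)" by auto
    have "v \<in> verts G" using X F[of X] C by (auto simp: circuit_def tight_def)
    moreover have "v \<notin> Y" using priv' Y by metis
    moreover have "\<forall>f\<in>A. v \<in> thull (ends G f) \<longrightarrow> thull (ends G f) \<inter> Y \<noteq> {}"
      using priv' Y(3) by (metis imageI)
    ultimately have "removable A e" unfolding removable_def e(2)[symmetric] by (intro bexI conjI)
    then show False using stable e by metis
  qed
  have "partition_on (verts G) ?F"
  proof (rule partition_onI)
    show "\<Union>?F = verts G" using circ cover by (fastforce simp: circuit_def tight_def)
    show "disjnt X Y" if "X \<in> ?F" "Y \<in> ?F" "X \<noteq> Y" for X Y
      using disj that C unfolding disjnt_def by (metis empty_iff)
    show "{} \<notin> ?F" using F[of "{}"] by (auto simp: circuit_def tight_def)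
  qed
  then show ?thesis using circ by (auto simp: circuit_decomposition_iff)
qed

end

section \<open>Sweeps with a decreasing potential\<close>

primrec iterate :: "(nat \<Rightarrow> 's \<Rightarrow> 's) \<Rightarrow> nat \<Rightarrow> 's \<Rightarrow> 's" where
  "iterate f 0 s = s"
| "iterate f (Suc n) s = f n (iterate f n s)"

lemma iterate_invariant:
  assumes "I 0 s" and "\<And>i s. i < n \<Longrightarrow> I i s \<Longrightarrow> I (Suc i) (f i s)"
  shows "I n (iterate f n s)"
  using assms by (induction n) auto

lemma sweep_decreases:
  fixes \<phi> :: "'s \<Rightarrow> nat"
  assumes step: "\<And>i s. i < m \<Longrightarrow> I s \<Longrightarrow> I (f i s) \<and> (f i s = s \<or> \<phi> (f i s) < \<phi> s)" and s: "I s"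
  shows "I (iterate f m s) \<and>
    (iterate f m s = s \<and> (\<forall>i<m. f i s = s) \<or> \<phi> (iterate f m s) < \<phi> s)"
  using step
proof (induction m)
  case (Suc m)
  have IH: "I (iterate f m s) \<and>
    (iterate f m s = s \<and> (\<forall>i<m. f i s = s) \<or> \<phi> (iterate f m s) < \<phi> s)"
    by (rule Suc.IH) (use Suc.prems in auto)
  then have "I (f m (iterate f m s)) \<and> (f m (iterate f m s) = iterate f m s \<or>
     \<phi> (f m (iterate f m s)) < \<phi> (iterate f m s))"
    by (intro Suc.prems) auto
  with IH show ?case by (auto simp: less_Suc_eq)
qed (use s in simp)

text \<open>A sweep that changes anything decreases the potential, and a sweep that changes nothing is
repeated forever. So as many sweeps as the initial potential reach a state that no single step
changes.\<close>

lemma sweeps_reach_fixpoint: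
  fixes \<phi> :: "'s \<Rightarrow> nat"
  assumes step: "\<And>i s. i < m \<Longrightarrow> I s \<Longrightarrow> I (f i s) \<and> (f i s = s \<or> \<phi> (f i s) < \<phi> s)" and s: "I s"
    and K: "\<phi> s \<le> K"
  defines "s' \<equiv> iterate (\<lambda>_. iterate f m) K s"
  shows "I s'" and "\<And>i. i < m \<Longrightarrow> f i s' = s'"
proof -
  have "I (iterate (\<lambda>_. iterate f m) k s) \<and>
    ((\<forall>i<m. f i (iterate (\<lambda>_. iterate f m) k s) = iterate (\<lambda>_. iterate f m) k s) \<or>
     \<phi> (iterate (\<lambda>_. iterate f m) k s) + k \<le> \<phi> s)" for k
  proof (induction k)
    case (Suc k)
    let ?t = "iterate (\<lambda>_. iterate f m) k s"
    have "I (iterate f m ?t) \<and>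
      (iterate f m ?t = ?t \<and> (\<forall>i<m. f i ?t = ?t) \<or> \<phi> (iterate f m ?t) < \<phi> ?t)"
      by (rule sweep_decreases) (use step Suc in auto)
    moreover have "iterate f m ?t = ?t" if "\<forall>i<m. f i ?t = ?t"
      by (rule iterate_invariant[of "\<lambda>_ u. u = ?t"]) (use that in auto)
    ultimately show ?case using Suc by auto
  qed (use s in auto)
  from this[of K] have I: "I s'" and
    or: "(\<forall>i<m. f i s' = s') \<or> \<phi> s' + K \<le> \<phi> s" by (auto simp: s'_def)
  show "I s'" by (rule I)
  show "f i s' = s'" if "i < m" for i
  proof (rule ccontr)
    assume "f i s' \<noteq> s'"
    moreover from this have "\<phi> s' = 0" using or that K by auto
    ultimately show False using step[OF that I] by simp
  qed
qed

section \<open>Hulls by load balancing\<close>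

text \<open>Edge \<open>f\<close> gives \<open>x f\<close> of its \<open>M\<close> units to its end \<open>a f\<close> and the others to \<open>b f\<close>; \<open>ex\<close> are
the additional units of the vertices.\<close>

definition load ::
  "'e set \<Rightarrow> ('e \<Rightarrow> 'v) \<Rightarrow> ('e \<Rightarrow> 'v) \<Rightarrow> nat \<Rightarrow> ('v \<Rightarrow> nat) \<Rightarrow> ('e \<Rightarrow> nat) \<Rightarrow> 'v \<Rightarrow> nat" where
  "load E a b M ex x v =
     ex v + (\<Sum>f\<in>E. (if a f = v then x f else 0) + (if b f = v then M - x f else 0))"

definition rebalance ::
  "'e set \<Rightarrow> ('e \<Rightarrow> 'v) \<Rightarrow> ('e \<Rightarrow> 'v) \<Rightarrow> nat \<Rightarrow> ('v \<Rightarrow> nat) \<Rightarrow> 'e \<Rightarrow> ('e \<Rightarrow> nat) \<Rightarrow> ('e \<Rightarrow> nat)" where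
  "rebalance E a b M ex f x = x(f :=
     (if x f < M \<and> load E a b M ex x (a f) + 2 \<le> load E a b M ex x (b f) then x f + 1
      else if 0 < x f \<and> load E a b M ex x (b f) + 2 \<le> load E a b M ex x (a f) then x f - 1
      else x f))"

text \<open>The equation is arranged so that no load is subtracted from.\<close>

lemma load_increase:
  assumes E: "finite E" "f \<in> E" and x: "x f < M"
  shows "load E a b M ex (x(f := Suc (x f))) v + (if b f = v then 1 else 0)
    = load E a b M ex x v + (if a f = v then 1 else 0)"
proof -
  let ?t = "\<lambda>x g. (if a g = v then x g else 0) + (if b g = v then M - x g else 0)"
  have "(\<Sum>g\<in>E - {f}. ?t (x(f := Suc (x f))) g) = (\<Sum>g\<in>E - {f}. ?t x g)"
    by (intro sum.cong) auto
  then show ?thesis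
    using sum.remove[OF E, of "?t x"] sum.remove[OF E, of "?t (x(f := Suc (x f)))"] x
    by (auto simp: load_def)
qed

lemma sum_load:
  assumes E: "finite E" and S: "finite S"
  shows "(\<Sum>v\<in>S. load E a b M ex x v) = (\<Sum>v\<in>S. ex v) +
    (\<Sum>f\<in>E. (if a f \<in> S then x f else 0) + (if b f \<in> S then M - x f else 0))"
proof -
  have "(\<Sum>v\<in>S. \<Sum>f\<in>E. (if a f = v then x f else 0) + (if b f = v then M - x f else 0))
    = (\<Sum>f\<in>E. \<Sum>v\<in>S. (if a f = v then x f else 0) + (if b f = v then M - x f else 0))"
    by (rule sum.swap)
  then show ?thesis using S by (simp add: load_def sum.distrib)
qed

text \<open>For \<open>L q = L p + 2 + d\<close>, moving a unit from \<open>q\<close> to \<open>p\<close> lowers \<open>(L p)\<^sup>2 + (L q)\<^sup>2\<close> by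
\<open>2(d + 1)\<close>.\<close>

lemma move_decreases_squares:
  fixes L L' :: "'v \<Rightarrow> nat"
  assumes V: "finite V" "p \<in> V" "q \<in> V" "p \<noteq> q"
    and L: "\<And>v. L' v + (if q = v then 1 else 0) = L v + (if p = v then 1 else 0)"
    and pq: "L p + 2 \<le> L q"
  shows "(\<Sum>v\<in>V. (L' v)\<^sup>2) < (\<Sum>v\<in>V. (L v)\<^sup>2)"
proof -
  have split: "(\<Sum>v\<in>V. h v) = h p + (h q + (\<Sum>v\<in>V - {p} - {q}. h v))" for h :: "'v \<Rightarrow> nat"
    using V sum.remove[of V p h] sum.remove[of "V - {p}" q h] by simp
  have rest: "(\<Sum>v\<in>V - {p} - {q}. (L' v)\<^sup>2) = (\<Sum>v\<in>V - {p} - {q}. (L v)\<^sup>2)"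
  proof (intro sum.cong refl)
    fix v assume "v \<in> V - {p} - {q}"
    then show "(L' v)\<^sup>2 = (L v)\<^sup>2" using L[of v] by auto
  qed
  obtain d where d: "L q = L p + 2 + d" using pq le_Suc_ex by blast
  have "L' p = L p + 1" "L' q = L p + 1 + d" using L[of p] L[of q] V d by auto
  then have "(L' p)\<^sup>2 + (L' q)\<^sup>2 < (L p)\<^sup>2 + (L q)\<^sup>2"
    using d by (simp add: power2_eq_square algebra_simps)
  then show ?thesis unfolding split[of "\<lambda>v. (L' v)\<^sup>2"] split[of "\<lambda>v. (L v)\<^sup>2"] rest by simp
qed

lemma rebalance_decreases:
  assumes V: "finite V" "a f \<in> V" "b f \<in> V" "a f \<noteq> b f" and E: "finite E" "f \<in> E"
    and x: "x f \<le> M"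
  shows "rebalance E a b M ex f x = x \<or>
    (\<Sum>v\<in>V. (load E a b M ex (rebalance E a b M ex f x) v)\<^sup>2) < (\<Sum>v\<in>V. (load E a b M ex x v)\<^sup>2)"
proof -
  let ?L = "load E a b M ex" let ?x' = "rebalance E a b M ex f x"
  let ?U = "x f < M \<and> ?L x (a f) + 2 \<le> ?L x (b f)"
  let ?D = "0 < x f \<and> ?L x (b f) + 2 \<le> ?L x (a f)"
  have stay: "?x' = x" if "\<not> ?U" "\<not> ?D"
    unfolding rebalance_def if_not_P[OF that(1)] if_not_P[OF that(2)] by (rule fun_upd_triv)
  have down: "?x' = x(f := x f - 1)" if "\<not> ?U" "?D"
    unfolding rebalance_def if_not_P[OF that(1)] if_P[OF that(2)] by (rule refl)
  show ?thesis
  proof (cases ?U)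
    case True
    then have up: "x f < M" "?L x (a f) + 2 \<le> ?L x (b f)" by simp_all
    then have x': "?x' = x(f := Suc (x f))" by (simp add: rebalance_def)
    have "?L ?x' v + (if b f = v then 1 else 0) = ?L x v + (if a f = v then 1 else 0)" for v
      unfolding x' by (rule load_increase[where x = x, OF E up(1)])
    then have "(\<Sum>v\<in>V. (?L ?x' v)\<^sup>2) < (\<Sum>v\<in>V. (?L x v)\<^sup>2)"
      using V up(2) by (intro move_decreases_squares[where p = "a f" and q = "b f"]) metis+
    then show ?thesis ..
  next
    case U: False
    show ?thesis
    proof (cases ?D)
      case True
      then have D: "0 < x f" "?L x (b f) + 2 \<le> ?L x (a f)" by simp_all
      have inv: "x = ?x'(f := Suc (?x' f))" "?x' f < M" using down[OF U True] D x by auto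
      have inc: "?L x v + (if b f = v then 1 else 0) = ?L ?x' v + (if a f = v then 1 else 0)" for v
        using load_increase[where x = ?x', OF E inv(2), of a b ex v] inv(1) by metis
      have "?L ?x' v + (if a f = v then 1 else 0) = ?L x v + (if b f = v then 1 else 0)" for v
        using inc[of v] by (rule sym)
      then have "(\<Sum>v\<in>V. (?L ?x' v)\<^sup>2) < (\<Sum>v\<in>V. (?L x v)\<^sup>2)"
        using V D(2) by (intro move_decreases_squares[where p = "b f" and q = "a f"]) metis+
      then show ?thesis ..
    next
      case False
      then show ?thesis using stay[OF U False] by simp
    qed
  qed
qed

context sparse_graph
begin

text \<open>The constants \<open>2M\<close> and \<open>D < M\<close> single out the tight sets that contain \<open>r\<close> and \<open>s\<close>: a set
\<open>S\<close> has \<open>M i(S)\<close> units from its edges, which is at most \<open>2M|S| - 2M\<close> and, unless \<open>S\<close> is tight,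
at most \<open>2M|S| - 3M\<close>. Together with the extra units it exceeds \<open>2M|S|\<close> only if it contains both
vertices and is tight, and then by exactly \<open>D\<close>. The condition \<open>D > 2n\<^sup>2\<close> makes some load in the
hull larger than \<open>2M + 2n\<close>, so that missing values can be chosen on both sides of the threshold
\<open>2M + n\<close>.\<close>

lemma balanced_load_thull:
  fixes a b :: "'e \<Rightarrow> 'v" and x :: "'e \<Rightarrow> nat" and M D :: nat and r s :: 'v
  defines "ex \<equiv> \<lambda>v. (if v = r then 2 * M else 0) + (if v = s then D else 0)"
  defines "L \<equiv> load (edges G) a b M ex x"
  defines "n \<equiv> card (verts G)"
  assumes ab: "\<And>f. f \<in> edges G \<Longrightarrow> ends G f = {a f, b f}"
    and rs: "r \<in> verts G" "s \<in> verts G" "r \<noteq> s"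
    and D: "2 * n * n < D" "D < M"
    and x: "\<And>f. f \<in> edges G \<Longrightarrow> x f \<le> M"
    and stable: "\<And>f. f \<in> edges G \<Longrightarrow> rebalance (edges G) a b M ex f x = x"
  shows "{v \<in> verts G. 2 * M + n < L v} = thull {r, s}"
proof -
  let ?T = "thull {r, s}"
  have T: "tight ?T" "r \<in> ?T" "s \<in> ?T"
    using tight_thull[of "{r, s}"] rs thull_superset[of "{r, s}"] by auto
  have neq: "a f \<noteq> b f" if "f \<in> edges G" for f using card_ends[OF that] ab[OF that] by auto
  have st1: "L (b f) \<le> L (a f) + 1" if f: "f \<in> edges G" "x f < M" for f
  proof (rule ccontr)
    assume "\<not> ?thesis"
    then have "rebalance (edges G) a b M ex f x f = x f + 1"
      using f by (simp add: rebalance_def L_def)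
    then show False using stable[OF f(1)] by simp
  qed
  have st2: "L (a f) \<le> L (b f) + 1" if f: "f \<in> edges G" "0 < x f" for f
  proof (rule ccontr)
    assume "\<not> ?thesis"
    then have "rebalance (edges G) a b M ex f x f = x f - 1"
      using f by (simp add: rebalance_def L_def)
    then show False using stable[OF f(1)] f by simp
  qed
  have fin: "finite S" if "S \<subseteq> verts G" for S using that finite_verts finite_subset by blast
  have ex_sum: "(\<Sum>v\<in>S. ex v) = (if r \<in> S then 2 * M else 0) + (if s \<in> S then D else 0)"
    if "S \<subseteq> verts G" for S
    using fin[OF that] by (simp add: ex_def sum.distrib)
  have in_sum: "(\<Sum>f\<in>edges G. if f \<in> inside G S then M else 0) = M * card (inside G S)" for S
    using finite_edges by (simp add: sum.If_cases inside_def Collect_conj_eq)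
  have lower: "(\<Sum>v\<in>S. ex v) + M * card (inside G S) \<le> (\<Sum>v\<in>S. L v)" if "S \<subseteq> verts G" for S
    unfolding L_def sum_load[OF finite_edges fin[OF that]] in_sum[symmetric]
    by (intro add_left_mono sum_mono) (use ab x in \<open>auto simp: inside_def\<close>)
  have card_split: "card S = card (S - ?T) + card ?T" if "?T \<subseteq> S" "finite S" for S
    using that by (metis card_Diff_subset card_mono finite_subset le_add_diff_inverse2)
  \<comment> \<open>At a missing value \<open>t\<close> loads above and below differ by at least 2, so an edge across the
    boundary gives all its units to its lower end.\<close>
  have above: "{v \<in> verts G. t < L v} = ?T"
    if t: "2 * M \<le> t" "\<And>v. v \<in> verts G \<Longrightarrow> L v \<noteq> t" and ne: "{v \<in> verts G. t < L v} \<noteq> {}" for t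
  proof -
    let ?S = "{v \<in> verts G. t < L v}"
    have S: "?S \<subseteq> verts G" by auto
    have "(\<Sum>f\<in>edges G. (if a f \<in> ?S then x f else 0) + (if b f \<in> ?S then M - x f else 0))
      = (\<Sum>f\<in>edges G. if f \<in> inside G ?S then M else 0)"
    proof (intro sum.cong refl)
      fix f assume f: "f \<in> edges G"
      have v: "a f \<in> verts G" "b f \<in> verts G" using ends_verts[OF f] ab[OF f] by auto
      have c1: "x f = 0" if "a f \<in> ?S" "b f \<notin> ?S"
        using st2[OF f] t(2)[of "b f"] that v by fastforce
      have c2: "x f = M" if "a f \<notin> ?S" "b f \<in> ?S"
        using st1[OF f] t(2)[of "a f"] that v x[OF f] by fastforce
      have "f \<in> inside G ?S \<longleftrightarrow> a f \<in> ?S \<and> b f \<in> ?S" using f ab[OF f] by (auto simp: inside_def)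
      then show "(if a f \<in> ?S then x f else 0) + (if b f \<in> ?S then M - x f else 0)
        = (if f \<in> inside G ?S then M else 0)"
        using c1 c2 x[OF f] by (cases "a f \<in> ?S"; cases "b f \<in> ?S") (simp_all del: mem_Collect_eq)
    qed
    then have sumS: "(\<Sum>v\<in>?S. L v) = (\<Sum>v\<in>?S. ex v) + M * card (inside G ?S)"
      unfolding L_def[symmetric] using sum_load[OF finite_edges fin[OF S], of a b M ex x] in_sum[of ?S]
      by (simp add: L_def)
    have big: "2 * M * card Z < (\<Sum>v\<in>Z. L v)" if "Z \<subseteq> ?S" "Z \<noteq> {}" for Z
    proof -
      have "(\<Sum>v\<in>Z. 2 * M) < (\<Sum>v\<in>Z. L v)"
        using that t fin[of Z] S by (intro sum_strict_mono) auto
      then show ?thesis by (simp add: mult.commute)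
    qed
    have sp: "card (inside G ?S) + 2 \<le> 2 * card ?S" by (rule sparse[OF S ne])
    have "M * (card (inside G ?S) + 2) \<le> M * (2 * card ?S)" using sp by (rule mult_le_mono2)
    then have sp': "M * card (inside G ?S) + 2 * M \<le> 2 * M * card ?S" by (simp add: algebra_simps)
    have "2 * M * card ?S < (\<Sum>v\<in>?S. ex v) + M * card (inside G ?S)"
      using big[OF order.refl ne] sumS by simp
    then have "2 * M < (\<Sum>v\<in>?S. ex v)" and
      sp2: "2 * M * card ?S < (\<Sum>v\<in>?S. ex v) + M * card (inside G ?S)" using sp' by linarith+
    then have rsS: "r \<in> ?S" "s \<in> ?S" and exS: "(\<Sum>v\<in>?S. ex v) = 2 * M + D"
      unfolding ex_sum[OF S] using D by (auto split: if_splits)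
    have "card (inside G ?S) + 2 = 2 * card ?S"
    proof (rule ccontr)
      assume "\<not> ?thesis"
      then have "card (inside G ?S) + 3 \<le> 2 * card ?S" using sp by simp
      then have "M * (card (inside G ?S) + 3) \<le> M * (2 * card ?S)" by (rule mult_le_mono2)
      then have "M * card (inside G ?S) + 3 * M \<le> 2 * M * card ?S" by (simp add: algebra_simps)
      then show False using sp2 exS D by linarith
    qed
    then have tS: "tight ?S" using S ne by (simp add: tight_def)
    have TS: "?T \<subseteq> ?S" using tS rsS by (intro thull_least) auto
    have M_tight: "M * card (inside G Z) + 2 * M = 2 * M * card Z" if "tight Z" for Z
    proof -
      have "M * (card (inside G Z) + 2) = M * (2 * card Z)" using that by (simp add: tight_def)
      then show ?thesis by (simp add: algebra_simps)
    qed
    \<comment> \<open>The units of the edges inside the hull and of its two special vertices stay in the hull, so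
      it holds the whole excess and nothing is left to lift the other vertices above the average
      \<open>2M\<close>.\<close>
    have "(\<Sum>v\<in>?T. L v) \<ge> 2 * M * card ?T + D"
      using lower[of ?T] ex_sum[of ?T] T M_tight[OF T(1)] by (simp add: tight_def)
    moreover have "(\<Sum>v\<in>?S. L v) = 2 * M * card ?S + D"
      using sumS exS M_tight[OF tS] by linarith
    moreover have "(\<Sum>v\<in>?S. L v) = (\<Sum>v\<in>?S - ?T. L v) + (\<Sum>v\<in>?T. L v)"
      using TS fin[OF S] by (rule sum.subset_diff)
    moreover have "card ?S = card (?S - ?T) + card ?T"
      using TS fin[OF S] by (rule card_split)
    ultimately have "(\<Sum>v\<in>?S - ?T. L v) \<le> 2 * M * card (?S - ?T)"
      by (simp add: algebra_simps)
    then have "?S - ?T = {}" using big[of "?S - ?T"] by fastforce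
    then show ?thesis using TS by blast
  qed
  have gap: "\<exists>t\<in>{c..c + n}. \<forall>v\<in>verts G. L v \<noteq> t" for c
  proof (rule ccontr)
    assume "\<not> ?thesis"
    then have "{c..c + n} \<subseteq> L ` verts G" by (metis image_eqI subsetI)
    then have "card {c..c + n} \<le> card (verts G)" using finite_verts by (meson surj_card_le)
    then show False by (simp add: n_def)
  qed
  have "\<exists>v\<in>?T. 2 * M + 2 * n < L v"
  proof (rule ccontr)
    assume "\<not> ?thesis"
    then have "(\<Sum>v\<in>?T. L v) \<le> (\<Sum>v\<in>?T. 2 * M + 2 * n)" by (intro sum_mono) auto
    moreover have "(\<Sum>v\<in>?T. L v) \<ge> 2 * M * card ?T + D"
    proof -
      have "M * (card (inside G ?T) + 2) = M * (2 * card ?T)" using T by (simp add: tight_def)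
      then have "M * card (inside G ?T) + 2 * M = 2 * M * card ?T" by (simp add: algebra_simps)
      then show ?thesis using lower[of ?T] ex_sum[of ?T] T by (simp add: tight_def)
    qed
    moreover have "card ?T \<le> n"
      unfolding n_def using T finite_verts by (intro card_mono) (auto simp: tight_def)
    then have "2 * n * card ?T \<le> 2 * n * n" by (rule mult_le_mono2)
    ultimately show False using D(1) by (simp add: algebra_simps)
  qed
  then obtain v where v: "v \<in> verts G" "2 * M + 2 * n < L v" using T by (auto simp: tight_def)
  obtain t where t: "2 * M \<le> t" "t \<le> 2 * M + n" "\<forall>v\<in>verts G. L v \<noteq> t" using gap[of "2 * M"] by auto
  obtain u where u: "2 * M + n \<le> u" "u \<le> 2 * M + 2 * n" "\<forall>v\<in>verts G. L v \<noteq> u"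
    using gap[of "2 * M + n"] by auto
  have tT: "{v \<in> verts G. t < L v} = ?T" by (rule above) (use t v in auto)
  have uT: "{v \<in> verts G. u < L v} = ?T" by (rule above) (use u v in auto)
  show ?thesis
  proof (rule equalityI)
    have "{v \<in> verts G. 2 * M + n < L v} \<subseteq> {v \<in> verts G. t < L v}" using t(2) by auto
    then show "{v \<in> verts G. 2 * M + n < L v} \<subseteq> ?T" unfolding tT .
    have "{v \<in> verts G. u < L v} \<subseteq> {v \<in> verts G. 2 * M + n < L v}" using u(1) by auto
    then show "?T \<subseteq> {v \<in> verts G. 2 * M + n < L v}" unfolding uT .
  qed
qed

end

lemma sum_squares_le_square_sum:
  fixes h :: "'a \<Rightarrow> nat"
  assumes "finite A" shows "(\<Sum>v\<in>A. (h v)\<^sup>2) \<le> (\<Sum>v\<in>A. h v)\<^sup>2"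
proof -
  have "(h v)\<^sup>2 \<le> h v * (\<Sum>v\<in>A. h v)" if "v \<in> A" for v
    using that assms by (simp add: power2_eq_square member_le_sum)
  then have "(\<Sum>v\<in>A. (h v)\<^sup>2) \<le> (\<Sum>v\<in>A. h v * (\<Sum>v\<in>A. h v))" by (rule sum_mono)
  then show ?thesis by (simp add: power2_eq_square sum_distrib_right)
qed

text \<open>All loads together amount to \<open>mM + 2M + D\<close>, and the square of this bounds the initial
potential.\<close>

lemma balancing_finds_thull:
  fixes G :: "('v, nat) mgraph" and a b :: "nat \<Rightarrow> 'v" and r s :: 'v
  assumes G: "sparse_graph G" and E: "edges G = {..<m}"
    and ab: "\<And>f. f < m \<Longrightarrow> ends G f = {a f, b f}"
    and rs: "r \<in> verts G" "s \<in> verts G" "r \<noteq> s"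
    and D: "2 * card (verts G) * card (verts G) < D" "D < M"
    and K: "(m * M + 2 * M + D)\<^sup>2 \<le> K"
    and x: "\<And>f. f < m \<Longrightarrow> x f = 0"
  defines "ex \<equiv> \<lambda>v. (if v = r then 2 * M else 0) + (if v = s then D else 0)"
  defines "x' \<equiv> iterate (\<lambda>_. iterate (rebalance {..<m} a b M ex) m) K x"
  shows "{v \<in> verts G. 2 * M + card (verts G) < load {..<m} a b M ex x' v} = sparse_graph.thull G {r, s}"
proof -
  interpret sparse_graph G by (rule G)
  let ?I = "\<lambda>x. \<forall>f<m. x f \<le> M"
  let ?L = "load {..<m} a b M ex"
  let ?phi = "\<lambda>x. \<Sum>v\<in>verts G. (?L x v)\<^sup>2"
  have step: "?I (rebalance {..<m} a b M ex f y) \<and>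
      (rebalance {..<m} a b M ex f y = y \<or> ?phi (rebalance {..<m} a b M ex f y) < ?phi y)"
    if f: "f < m" and y: "?I y" for f y
  proof
    show "?I (rebalance {..<m} a b M ex f y)" using y f by (auto simp: rebalance_def)
    have fE: "f \<in> edges G" using f E by simp
    have "a f \<in> verts G" "b f \<in> verts G" "a f \<noteq> b f"
      using ends_verts[OF fE] card_ends[OF fE] ab[OF f] by auto
    then show "rebalance {..<m} a b M ex f y = y \<or> ?phi (rebalance {..<m} a b M ex f y) < ?phi y"
      using f y finite_verts by (intro rebalance_decreases) auto
  qed
  have Ix: "?I x" using x by simp
  have "(\<Sum>v\<in>verts G. ?L x v) = (\<Sum>v\<in>verts G. ex v) +
      (\<Sum>f<m. (if a f \<in> verts G then x f else 0) + (if b f \<in> verts G then M - x f else 0))"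
    by (rule sum_load[OF _ finite_verts]) simp
  also have "\<dots> \<le> (2 * M + D) + (\<Sum>f<m. M)"
  proof (intro add_mono sum_mono)
    show "(\<Sum>v\<in>verts G. ex v) \<le> 2 * M + D"
      using finite_verts by (simp add: ex_def sum.distrib)
  qed (use x in auto)
  also have "\<dots> = m * M + 2 * M + D" by simp
  finally have "(\<Sum>v\<in>verts G. ?L x v)\<^sup>2 \<le> (m * M + 2 * M + D)\<^sup>2" by (rule power_mono) simp
  with sum_squares_le_square_sum[OF finite_verts, of "?L x"] K have phi: "?phi x \<le> K" by linarith
  have fp1: "?I x'"
    unfolding x'_def by (rule sweeps_reach_fixpoint(1)[where \<phi> = ?phi, OF step Ix phi])
  have fp2: "rebalance {..<m} a b M ex f x' = x'" if "f < m" for f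
    unfolding x'_def by (rule sweeps_reach_fixpoint(2)[where \<phi> = ?phi, OF step Ix phi that])
  show ?thesis
    using balanced_load_thull[of a b r s D M x'] ab rs D fp1 fp2 unfolding E ex_def by simp
qed

section \<open>A loop language for the random access machine\<close>

text \<open>The language is designed so that both correctness and running time are easy to establish:
expressions contain bounded sums, which also serve as bounded quantifiers and as multiplication,
and all loops are counting loops, so that the semantics is a total function. Variables and
arrays are numbered.\<close>

datatype exp =
    Num nat | Var nat | Plus exp exp | Minus exp exp | Arr nat exp | Inp exp
  | Ite exp exp exp | Sum nat nat exp

datatype com = Assign nat exp | Update nat exp exp | Seq com com | For nat nat com

type_synonym env = "nat \<Rightarrow> nat"
type_synonym arrays = "nat \<Rightarrow> nat \<Rightarrow> nat"

primrec eval :: "nat list \<Rightarrow> arrays \<Rightarrow> exp \<Rightarrow> env \<Rightarrow> nat" where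
  "eval w A (Num c) s = c"
| "eval w A (Var x) s = s x"
| "eval w A (Plus e1 e2) s = eval w A e1 s + eval w A e2 s"
| "eval w A (Minus e1 e2) s = eval w A e1 s - eval w A e2 s"
| "eval w A (Arr a e) s = A a (eval w A e s)"
| "eval w A (Inp e) s = (if eval w A e s < length w then w ! eval w A e s else 0)"
| "eval w A (Ite b e1 e2) s = (if 0 < eval w A b s then eval w A e1 s else eval w A e2 s)"
| "eval w A (Sum x y e) s = (\<Sum>i<s y. eval w A e (s(x := i)))"

primrec sem :: "nat list \<Rightarrow> com \<Rightarrow> env \<times> arrays \<Rightarrow> env \<times> arrays" where
  "sem w (Assign x e) \<sigma> = ((fst \<sigma>)(x := eval w (snd \<sigma>) e (fst \<sigma>)), snd \<sigma>)"
| "sem w (Update a i e) \<sigma> = (fst \<sigma>, (snd \<sigma>)(a :=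
     (snd \<sigma> a)(eval w (snd \<sigma>) i (fst \<sigma>) := eval w (snd \<sigma>) e (fst \<sigma>))))"
| "sem w (Seq c1 c2) \<sigma> = sem w c2 (sem w c1 \<sigma>)"
| "sem w (For x y c) \<sigma> = iterate (\<lambda>i \<tau>. sem w c ((fst \<tau>)(x := i), snd \<tau>)) (fst \<sigma> y) \<sigma>"

section \<open>Compilation and running time\<close>

primrec exp_len :: "exp \<Rightarrow> nat" where
  "exp_len (Num c) = 1"
| "exp_len (Var x) = 2"
| "exp_len (Plus e1 e2) = exp_len e1 + exp_len e2 + 1"
| "exp_len (Minus e1 e2) = exp_len e1 + exp_len e2 + 1"
| "exp_len (Arr a e) = exp_len e + 5"
| "exp_len (Inp e) = exp_len e + 1"
| "exp_len (Ite b e1 e2) = exp_len b + exp_len e1 + exp_len e2 + 3"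
| "exp_len (Sum x y e) = exp_len e + 11"

text \<open>The code starts at address \<open>l\<close>, leaves the value in register \<open>d\<close> and uses the registers
from \<open>d\<close> on as scratch space. Element \<open>i\<close> of array \<open>a\<close> is held by register \<open>q + 4i + a\<close>, which
makes four unbounded arrays fit above the scratch space. An unconditional jump is a conditional
jump on a register that has just been set to 1.\<close>

primrec exp_code :: "nat \<Rightarrow> nat \<Rightarrow> nat \<Rightarrow> exp \<Rightarrow> instr list" where
  "exp_code q l d (Num c) = [Const d c]"
| "exp_code q l d (Var x) = [Const d 0, Add d d x]"
| "exp_code q l d (Plus e1 e2) =
     exp_code q l d e1 @ exp_code q (l + exp_len e1) (d + 1) e2 @ [Add d d (d + 1)]"
| "exp_code q l d (Minus e1 e2) =
     exp_code q l d e1 @ exp_code q (l + exp_len e1) (d + 1) e2 @ [Sub d d (d + 1)]"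
| "exp_code q l d (Arr a e) = exp_code q l d e @
     [Add d d d, Add d d d, Const (d + 1) (q + a), Add d d (d + 1), Load d d]"
| "exp_code q l d (Inp e) = exp_code q l d e @ [Read d d]"
| "exp_code q l d (Ite b e1 e2) = exp_code q l d b @
     [Jump_Pos d (l + exp_len b + exp_len e2 + 3)] @ exp_code q (l + exp_len b + 1) d e2 @
     [Const (d + 1) 1, Jump_Pos (d + 1) (l + exp_len b + exp_len e2 + exp_len e1 + 3)] @
     exp_code q (l + exp_len b + exp_len e2 + 3) d e1"
| "exp_code q l d (Sum x y e) =
     [Const d 0, Add (d + 1) x d, Add (d + 2) y d, Const x 0, Const (d + 3) 1] @
     [Jump_Pos (d + 3) (l + exp_len e + 9)] @
     exp_code q (l + 6) (d + 4) e @
     [Add d d (d + 4), Add x x (d + 3), Sub (d + 2) (d + 2) (d + 3)] @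
     [Jump_Pos (d + 2) (l + 6)] @ [Add x (d + 1) (d + 2)]"

primrec com_len :: "com \<Rightarrow> nat" where
  "com_len (Assign x e) = exp_len e + 2"
| "com_len (Update a i e) = exp_len i + exp_len e + 5"
| "com_len (Seq c1 c2) = com_len c1 + com_len c2"
| "com_len (For x y c) = com_len c + 9"

primrec com_code :: "nat \<Rightarrow> nat \<Rightarrow> nat \<Rightarrow> com \<Rightarrow> instr list" where
  "com_code q l d (Assign x e) = exp_code q l d e @ [Const x 0, Add x x d]"
| "com_code q l d (Update a i e) = exp_code q l d i @ exp_code q (l + exp_len i) (d + 1) e @
     [Add d d d, Add d d d, Const (d + 2) (q + a), Add d d (d + 2), Store d (d + 1)]"
| "com_code q l d (Seq c1 c2) = com_code q l d c1 @ com_code q (l + com_len c1) d c2"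
| "com_code q l d (For x y c) =
     [Const d 0, Add (d + 1) y d, Const (d + 2) 1] @ [Jump_Pos (d + 2) (l + com_len c + 8)] @
     [Const x 0, Add x x d] @ com_code q (l + 6) (d + 3) c @
     [Add d d (d + 2), Sub (d + 1) (d + 1) (d + 2)] @ [Jump_Pos (d + 1) (l + 4)]"

lemma length_exp_code: "length (exp_code q l d e) = exp_len e"
  by (induction e arbitrary: l d) auto

lemma length_com_code: "length (com_code q l d c) = com_len c"
  by (induction c arbitrary: l d) (auto simp: length_exp_code)

primrec exp_vars :: "exp \<Rightarrow> nat set" where
  "exp_vars (Num c) = {}"
| "exp_vars (Var x) = {x}"
| "exp_vars (Plus e1 e2) = exp_vars e1 \<union> exp_vars e2"
| "exp_vars (Minus e1 e2) = exp_vars e1 \<union> exp_vars e2"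
| "exp_vars (Arr a e) = exp_vars e"
| "exp_vars (Inp e) = exp_vars e"
| "exp_vars (Ite b e1 e2) = exp_vars b \<union> exp_vars e1 \<union> exp_vars e2"
| "exp_vars (Sum x y e) = {x, y} \<union> exp_vars e"

primrec exp_arrays :: "exp \<Rightarrow> nat set" where
  "exp_arrays (Num c) = {}"
| "exp_arrays (Var x) = {}"
| "exp_arrays (Plus e1 e2) = exp_arrays e1 \<union> exp_arrays e2"
| "exp_arrays (Minus e1 e2) = exp_arrays e1 \<union> exp_arrays e2"
| "exp_arrays (Arr a e) = {a} \<union> exp_arrays e"
| "exp_arrays (Inp e) = exp_arrays e"
| "exp_arrays (Ite b e1 e2) = exp_arrays b \<union> exp_arrays e1 \<union> exp_arrays e2"
| "exp_arrays (Sum x y e) = exp_arrays e"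

text \<open>The count adds up even where subexpressions share scratch registers, so it is only an
upper bound.\<close>

primrec exp_depth :: "exp \<Rightarrow> nat" where
  "exp_depth (Num c) = 1"
| "exp_depth (Var x) = 1"
| "exp_depth (Plus e1 e2) = exp_depth e1 + exp_depth e2 + 1"
| "exp_depth (Minus e1 e2) = exp_depth e1 + exp_depth e2 + 1"
| "exp_depth (Arr a e) = exp_depth e + 2"
| "exp_depth (Inp e) = exp_depth e + 1"
| "exp_depth (Ite b e1 e2) = exp_depth b + exp_depth e1 + exp_depth e2 + 2"
| "exp_depth (Sum x y e) = exp_depth e + 4"

primrec com_vars :: "com \<Rightarrow> nat set" where
  "com_vars (Assign x e) = {x} \<union> exp_vars e"
| "com_vars (Update a i e) = exp_vars i \<union> exp_vars e"
| "com_vars (Seq c1 c2) = com_vars c1 \<union> com_vars c2"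
| "com_vars (For x y c) = {x, y} \<union> com_vars c"

primrec com_arrays :: "com \<Rightarrow> nat set" where
  "com_arrays (Assign x e) = exp_arrays e"
| "com_arrays (Update a i e) = {a} \<union> exp_arrays i \<union> exp_arrays e"
| "com_arrays (Seq c1 c2) = com_arrays c1 \<union> com_arrays c2"
| "com_arrays (For x y c) = com_arrays c"

primrec com_depth :: "com \<Rightarrow> nat" where
  "com_depth (Assign x e) = exp_depth e"
| "com_depth (Update a i e) = exp_depth i + exp_depth e + 3"
| "com_depth (Seq c1 c2) = com_depth c1 + com_depth c2"
| "com_depth (For x y c) = com_depth c + 3"

text \<open>Bounds on the number of steps, as polynomials in a bound on the values of all variables,
and thus on the number of iterations of each loop.\<close>

primrec exp_time :: "exp \<Rightarrow> nat poly" where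
  "exp_time (Num c) = [:1:]"
| "exp_time (Var x) = [:2:]"
| "exp_time (Plus e1 e2) = exp_time e1 + exp_time e2 + [:1:]"
| "exp_time (Minus e1 e2) = exp_time e1 + exp_time e2 + [:1:]"
| "exp_time (Arr a e) = exp_time e + [:5:]"
| "exp_time (Inp e) = exp_time e + [:1:]"
| "exp_time (Ite b e1 e2) = exp_time b + exp_time e1 + exp_time e2 + [:3:]"
| "exp_time (Sum x y e) = [:0, 1:] * (exp_time e + [:4:]) + [:8:]"

primrec com_time :: "com \<Rightarrow> nat poly" where
  "com_time (Assign x e) = exp_time e + [:2:]"
| "com_time (Update a i e) = exp_time i + exp_time e + [:5:]"
| "com_time (Seq c1 c2) = com_time c1 + com_time c2"
| "com_time (For x y c) = [:0, 1:] * (com_time c + [:5:]) + [:5:]"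

text \<open>In the course of the run, \<open>B\<close> bounds all variables whenever an assignment or an array
update is executed, and the number of iterations of every loop. Without assignments, variables
change only by counting up to the value of another one, which keeps a common bound on all of
them intact (\<open>assign_free_bounded_run\<close>).\<close>

primrec bounded_run :: "nat list \<Rightarrow> nat \<Rightarrow> com \<Rightarrow> env \<times> arrays \<Rightarrow> bool" where
  "bounded_run w B (Assign x e) \<sigma> \<longleftrightarrow> (\<forall>z. fst \<sigma> z \<le> B)"
| "bounded_run w B (Update a i e) \<sigma> \<longleftrightarrow> (\<forall>z. fst \<sigma> z \<le> B)"
| "bounded_run w B (Seq c1 c2) \<sigma> \<longleftrightarrow> bounded_run w B c1 \<sigma> \<and> bounded_run w B c2 (sem w c1 \<sigma>)"
| "bounded_run w B (For x y c) \<sigma> \<longleftrightarrow> fst \<sigma> y \<le> B \<and>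
     (\<forall>i<fst \<sigma> y. bounded_run w B c (let \<tau> = iterate (\<lambda>i \<tau>. sem w c ((fst \<tau>)(x := i), snd \<tau>)) i \<sigma>
        in ((fst \<tau>)(x := i), snd \<tau>)))"

primrec assign_free :: "com \<Rightarrow> bool" where
  "assign_free (Assign x e) = False"
| "assign_free (Update a i e) = True"
| "assign_free (Seq c1 c2) = (assign_free c1 \<and> assign_free c2)"
| "assign_free (For x y c) = assign_free c"

lemma assign_free_bounded_run:
  assumes "assign_free c" "\<forall>z. fst \<sigma> z \<le> B"
  shows "bounded_run w B c \<sigma> \<and> (\<forall>z. fst (sem w c \<sigma>) z \<le> B)"
  using assms
proof (induction c arbitrary: \<sigma>)
  case (For x y c)
  let ?it = "\<lambda>k. iterate (\<lambda>i \<tau>. sem w c ((fst \<tau>)(x := i), snd \<tau>)) k \<sigma>"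
  have IH: "bounded_run w B c ((fst \<tau>)(x := i), snd \<tau>) \<and>
      (\<forall>z. fst (sem w c ((fst \<tau>)(x := i), snd \<tau>)) z \<le> B)"
    if "\<forall>z. fst \<tau> z \<le> B" "i < fst \<sigma> y" for \<tau> i
  proof -
    have "i \<le> B" using that For.prems by (meson le_trans less_imp_le)
    then show ?thesis using that For by (intro For.IH) auto
  qed
  have inv: "\<forall>z. fst (?it k) z \<le> B" if "k \<le> fst \<sigma> y" for k
    using that
  proof (induction k)
    case 0 then show ?case using For.prems by simp
  next
    case (Suc k)
    then have k: "k < fst \<sigma> y" by simp
    have "\<forall>z. fst (?it k) z \<le> B" by (rule Suc.IH) (use k in simp)
    from IH[OF this k] show ?case unfolding iterate.simps by blast
  qed
  show ?case using For.prems inv IH by (auto simp: Let_def)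
qed auto

definition code_at :: "instr list \<Rightarrow> nat \<Rightarrow> instr list \<Rightarrow> bool" where
  "code_at M l c \<longleftrightarrow> (\<exists>M1 M2. M = M1 @ c @ M2 \<and> length M1 = l)"

lemma code_at_append: "code_at M l (c1 @ c2) \<Longrightarrow> code_at M l c1 \<and> code_at M (l + length c1) c2"
  unfolding code_at_def by (metis append.assoc length_append)

text \<open>An upper bound \<open>T\<close> on the number of steps is easier to compose than their exact number.\<close>

definition reach :: "instr list \<Rightarrow> nat list \<Rightarrow> nat \<Rightarrow> nat \<times> (nat \<Rightarrow> nat) \<Rightarrow> nat \<times> (nat \<Rightarrow> nat) \<Rightarrow> bool" where
  "reach M w T c c' \<longleftrightarrow> (\<exists>t\<le>T. (ram_step M w ^^ t) c = c')"

lemma reach_refl: "reach M w T c c"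
  unfolding reach_def by (intro exI[of _ 0]) simp

lemma reach_trans:
  assumes "reach M w T1 c c'" "reach M w T2 c' c''" "T1 + T2 \<le> T"
  shows "reach M w T c c''"
proof -
  obtain t1 t2 where "t1 \<le> T1" "(ram_step M w ^^ t1) c = c'" "t2 \<le> T2" "(ram_step M w ^^ t2) c' = c''"
    using assms by (auto simp: reach_def)
  then have "(ram_step M w ^^ (t2 + t1)) c = c''" "t2 + t1 \<le> T"
    using assms by (auto simp: funpow_add)
  then show ?thesis unfolding reach_def by blast
qed

lemma reach_instr:
  assumes "code_at M l [i]" shows "reach M w 1 (l, R) (exec_instr w i (l, R))"
proof -
  have "l < length M" "M ! l = i" using assms by (auto simp: code_at_def nth_append)
  then show ?thesis unfolding reach_def by (intro exI[of _ 1]) (simp add: ram_step_def)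
qed

fun effect :: "nat list \<Rightarrow> instr list \<Rightarrow> (nat \<Rightarrow> nat) \<Rightarrow> (nat \<Rightarrow> nat)" where
  "effect w [] R = R"
| "effect w (i # is) R = effect w is (snd (exec_instr w i (0, R)))"

fun is_jump :: "instr \<Rightarrow> bool" where
  "is_jump (Jump_Pos i l) = True"
| "is_jump _ = False"

lemma reach_straight:
  assumes "code_at M l c" "\<forall>i\<in>set c. \<not> is_jump i" "length c = n"
  shows "reach M w n (l, R) (l + n, effect w c R)"
  using assms
proof (induction c arbitrary: l R n)
  case Nil then show ?case by (simp add: reach_refl)
next
  case (Cons i c)
  have c: "code_at M l [i]" "code_at M (l + 1) c"
    using code_at_append[of M l "[i]" c] Cons.prems by auto
  have "exec_instr w i (l, R) = (l + 1, snd (exec_instr w i (0, R)))"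
    using Cons.prems by (cases i) auto
  then have 1: "reach M w 1 (l, R) (l + 1, snd (exec_instr w i (0, R)))"
    using reach_instr[OF c(1)] by metis
  show ?case by (rule reach_trans[OF 1, where ?T2.0 = "length c"]) (use Cons.IH[OF c(2)] Cons.prems in auto)
qed

definition represents :: "nat \<Rightarrow> nat \<Rightarrow> (nat \<Rightarrow> nat) \<Rightarrow> env \<Rightarrow> arrays \<Rightarrow> bool" where
  "represents h q R s A \<longleftrightarrow> (\<forall>x<h. R x = s x) \<and> (\<forall>a<4. \<forall>i. R (q + 4 * i + a) = A a i)"

lemma represents_cong:
  assumes "represents h q R s A" "\<And>r. r < h \<or> q \<le> r \<Longrightarrow> R' r = R r"
  shows "represents h q R' s A"
  using assms by (auto simp: represents_def)

text \<open>In the code of a sum, \<open>d\<close> accumulates the result, \<open>d + 1\<close> saves the old value of the bound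
variable, which is restored at the end, \<open>d + 2\<close> counts the remaining iterations and \<open>d + 3\<close>
holds the constant 1.\<close>

lemma exp_code_correct:
  assumes "code_at M l (exp_code q l d e)" "represents h q R s A" "h \<le> d" "d + exp_depth e \<le> q"
    "exp_vars e \<subseteq> {..<h}" "exp_arrays e \<subseteq> {..<4}" "\<forall>x. s x \<le> B"
  shows "\<exists>R'. reach M w (poly (exp_time e) B) (l, R) (l + exp_len e, R') \<and>
    R' d = eval w A e s \<and> (\<forall>r. r < d \<or> q \<le> r \<longrightarrow> R' r = R r)"
  using assms
proof (induction e arbitrary: l d R s)
  case (Num c)
  show ?case
  proof (intro exI conjI)
    show "reach M w (poly (exp_time (Num c)) B) (l, R) (l + exp_len (Num c), R(d := c))"
      using reach_instr[of M l "Const d c" w R] Num.prems by simp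
  qed (use Num.prems in auto)
next
  case (Var x)
  have "R x = s x" using Var.prems by (auto simp: represents_def)
  then have "reach M w (poly (exp_time (Var x)) B) (l, R) (l + exp_len (Var x), R(d := s x))"
    using reach_straight[of M l "[Const d 0, Add d d x]" 2 w R] Var.prems by simp
  moreover have "(R(d := s x)) d = eval w A (Var x) s" using Var.prems by auto
  moreover have "\<forall>r. r < d \<or> q \<le> r \<longrightarrow> (R(d := s x)) r = R r" using Var.prems by auto
  ultimately show ?case by blast
next
  case (Plus e1 e2)
  have c: "code_at M l (exp_code q l d e1)"
    "code_at M (l + exp_len e1) (exp_code q (l + exp_len e1) (d + 1) e2)"
    "code_at M (l + exp_len e1 + exp_len e2) [Add d d (d + 1)]"
    using Plus.prems(1) by (auto dest!: code_at_append simp: length_exp_code add.assoc)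
  obtain R1 where R1: "reach M w (poly (exp_time e1) B) (l, R) (l + exp_len e1, R1)"
    "R1 d = eval w A e1 s" "\<forall>r. r < d \<or> q \<le> r \<longrightarrow> R1 r = R r"
    using Plus.IH(1)[of l d R s] Plus.prems c by auto
  have rep: "represents h q R1 s A"
    by (rule represents_cong[OF Plus.prems(2)]) (use R1 Plus.prems in auto)
  obtain R2 where R2: "reach M w (poly (exp_time e2) B) (l + exp_len e1, R1) (l + exp_len e1 + exp_len e2, R2)"
    "R2 (d + 1) = eval w A e2 s" "\<forall>r. r < d + 1 \<or> q \<le> r \<longrightarrow> R2 r = R1 r"
    using Plus.IH(2)[of "l + exp_len e1" "d + 1" R1 s] Plus.prems rep c by auto
  have 3: "reach M w 1 (l + exp_len e1 + exp_len e2, R2)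
      (l + exp_len e1 + exp_len e2 + 1, R2(d := R2 d + R2 (d + 1)))"
    using reach_instr[OF c(3)] by simp
  have "reach M w (poly (exp_time (Plus e1 e2)) B) (l, R)
      (l + exp_len (Plus e1 e2), R2(d := R2 d + R2 (d + 1)))"
    using reach_trans[OF reach_trans[OF R1(1) R2(1) order.refl] 3 order.refl] by (simp add: add.assoc)
  moreover have "(R2(d := R2 d + R2 (d + 1))) d = eval w A (Plus e1 e2) s" using R1 R2 Plus.prems by auto
  moreover have "\<forall>r. r < d \<or> q \<le> r \<longrightarrow> (R2(d := R2 d + R2 (d + 1))) r = R r" using R1 R2 Plus.prems by auto
  ultimately show ?case by blast
next
  case (Minus e1 e2)
  have c: "code_at M l (exp_code q l d e1)"
    "code_at M (l + exp_len e1) (exp_code q (l + exp_len e1) (d + 1) e2)"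
    "code_at M (l + exp_len e1 + exp_len e2) [Sub d d (d + 1)]"
    using Minus.prems(1) by (auto dest!: code_at_append simp: length_exp_code add.assoc)
  obtain R1 where R1: "reach M w (poly (exp_time e1) B) (l, R) (l + exp_len e1, R1)"
    "R1 d = eval w A e1 s" "\<forall>r. r < d \<or> q \<le> r \<longrightarrow> R1 r = R r"
    using Minus.IH(1)[of l d R s] Minus.prems c by auto
  have rep: "represents h q R1 s A"
    by (rule represents_cong[OF Minus.prems(2)]) (use R1 Minus.prems in auto)
  obtain R2 where R2: "reach M w (poly (exp_time e2) B) (l + exp_len e1, R1) (l + exp_len e1 + exp_len e2, R2)"
    "R2 (d + 1) = eval w A e2 s" "\<forall>r. r < d + 1 \<or> q \<le> r \<longrightarrow> R2 r = R1 r"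
    using Minus.IH(2)[of "l + exp_len e1" "d + 1" R1 s] Minus.prems rep c by auto
  have 3: "reach M w 1 (l + exp_len e1 + exp_len e2, R2)
      (l + exp_len e1 + exp_len e2 + 1, R2(d := R2 d - R2 (d + 1)))"
    using reach_instr[OF c(3)] by simp
  have "reach M w (poly (exp_time (Minus e1 e2)) B) (l, R)
      (l + exp_len (Minus e1 e2), R2(d := R2 d - R2 (d + 1)))"
    using reach_trans[OF reach_trans[OF R1(1) R2(1) order.refl] 3 order.refl] by (simp add: add.assoc)
  moreover have "(R2(d := R2 d - R2 (d + 1))) d = eval w A (Minus e1 e2) s" using R1 R2 Minus.prems by auto
  moreover have "\<forall>r. r < d \<or> q \<le> r \<longrightarrow> (R2(d := R2 d - R2 (d + 1))) r = R r" using R1 R2 Minus.prems by auto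
  ultimately show ?case by blast
next
  case (Arr a e)
  let ?c = "[Add d d d, Add d d d, Const (d + 1) (q + a), Add d d (d + 1), Load d d]"
  have c: "code_at M l (exp_code q l d e)" "code_at M (l + exp_len e) ?c"
    using Arr.prems(1) by (auto dest!: code_at_append simp: length_exp_code)
  obtain R1 where R1: "reach M w (poly (exp_time e) B) (l, R) (l + exp_len e, R1)"
    "R1 d = eval w A e s" "\<forall>r. r < d \<or> q \<le> r \<longrightarrow> R1 r = R r"
    using Arr.IH[of l d R s] Arr.prems c by auto
  have rep: "represents h q R1 s A"
    by (rule represents_cong[OF Arr.prems(2)]) (use R1 Arr.prems in auto)
  have r: "R1 (i + i + (i + i) + (q + a)) = A a i" for i
  proof -
    have "R1 (q + 4 * i + a) = A a i" using rep Arr.prems by (auto simp: represents_def)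
    moreover have "q + 4 * i + a = i + i + (i + i) + (q + a)" by simp
    ultimately show ?thesis by simp
  qed
  have 2: "reach M w 5 (l + exp_len e, R1) (l + exp_len e + 5, effect w ?c R1)"
    by (rule reach_straight[OF c(2)]) simp_all
  have "reach M w (poly (exp_time (Arr a e)) B) (l, R) (l + exp_len (Arr a e), effect w ?c R1)"
    using reach_trans[OF R1(1) 2 order.refl] by (simp add: add.assoc)
  moreover have "R1 d + R1 d + (R1 d + R1 d) + (q + a) \<noteq> d"
    "R1 d + R1 d + (R1 d + R1 d) + (q + a) \<noteq> d + 1" using Arr.prems by auto
  then have "effect w ?c R1 d = R1 (R1 d + R1 d + (R1 d + R1 d) + (q + a))" by simp
  then have "effect w ?c R1 d = eval w A (Arr a e) s" unfolding r R1(2) by simp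
  moreover have "\<forall>r. r < d \<or> q \<le> r \<longrightarrow> effect w ?c R1 r = R r" using R1 Arr.prems by auto
  ultimately show ?case by blast
next
  case (Inp e)
  have c: "code_at M l (exp_code q l d e)" "code_at M (l + exp_len e) [Read d d]"
    using Inp.prems(1) by (auto dest!: code_at_append simp: length_exp_code)
  obtain R1 where R1: "reach M w (poly (exp_time e) B) (l, R) (l + exp_len e, R1)"
    "R1 d = eval w A e s" "\<forall>r. r < d \<or> q \<le> r \<longrightarrow> R1 r = R r"
    using Inp.IH[of l d R s] Inp.prems c by auto
  have 2: "reach M w 1 (l + exp_len e, R1) (l + exp_len e + 1, effect w [Read d d] R1)"
    by (rule reach_straight[OF c(2)]) simp_all
  have "reach M w (poly (exp_time (Inp e)) B) (l, R) (l + exp_len (Inp e), effect w [Read d d] R1)"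
    using reach_trans[OF R1(1) 2 order.refl] by (simp add: add.assoc)
  moreover have "effect w [Read d d] R1 d = eval w A (Inp e) s" using R1 Inp.prems by auto
  moreover have "\<forall>r. r < d \<or> q \<le> r \<longrightarrow> effect w [Read d d] R1 r = R r" using R1 Inp.prems by auto
  ultimately show ?case by blast
next
  case (Ite b e1 e2)
  let ?l1 = "l + exp_len b" let ?l2 = "?l1 + exp_len e2" let ?end = "?l2 + exp_len e1 + 3"
  have c: "code_at M l (exp_code q l d b)" "code_at M ?l1 [Jump_Pos d (?l2 + 3)]"
    "code_at M (?l1 + 1) (exp_code q (?l1 + 1) d e2)"
    "code_at M (?l2 + 1) [Const (d + 1) 1]" "code_at M (?l2 + 2) [Jump_Pos (d + 1) ?end]"
    "code_at M (?l2 + 3) (exp_code q (?l2 + 3) d e1)"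
  proof -
    note 1 = code_at_append[OF Ite.prems(1)[unfolded exp_code.simps], unfolded length_exp_code]
    note 2 = code_at_append[OF 1[THEN conjunct2]]
    note 3 = code_at_append[OF 2[THEN conjunct2], unfolded length_exp_code]
    note 4 = code_at_append[OF 3[THEN conjunct2]]
    note 5 = code_at_append[of M _ "[Const (d + 1) 1]" "[Jump_Pos (d + 1) ?end]", simplified]
    show "code_at M l (exp_code q l d b)" using 1 by simp
    show "code_at M ?l1 [Jump_Pos d (?l2 + 3)]" using 2 by (simp add: eval_nat_numeral)
    show "code_at M (?l1 + 1) (exp_code q (?l1 + 1) d e2)" using 3 by (simp add: eval_nat_numeral)
    show "code_at M (?l2 + 3) (exp_code q (?l2 + 3) d e1)" using 4 by (simp add: ac_simps eval_nat_numeral)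
    show "code_at M (?l2 + 1) [Const (d + 1) 1]" "code_at M (?l2 + 2) [Jump_Pos (d + 1) ?end]"
      using 4 5 by (simp_all add: ac_simps eval_nat_numeral)
  qed
  obtain R1 where R1: "reach M w (poly (exp_time b) B) (l, R) (?l1, R1)"
    "R1 d = eval w A b s" "\<forall>r. r < d \<or> q \<le> r \<longrightarrow> R1 r = R r"
    using Ite.IH(1)[of l d R s] Ite.prems c by auto
  have rep: "represents h q R1 s A"
    by (rule represents_cong[OF Ite.prems(2)]) (use R1 Ite.prems in auto)
  show ?case
  proof (cases "0 < eval w A b s")
    case True
    have 2: "reach M w 1 (?l1, R1) (?l2 + 3, R1)" using reach_instr[OF c(2), of w R1] R1 True by simp
    obtain R2 where R2: "reach M w (poly (exp_time e1) B) (?l2 + 3, R1) (?l2 + 3 + exp_len e1, R2)"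
      "R2 d = eval w A e1 s" "\<forall>r. r < d \<or> q \<le> r \<longrightarrow> R2 r = R1 r"
      using Ite.IH(2)[of "?l2 + 3" d R1 s] Ite.prems rep c by auto
    have "reach M w (poly (exp_time (Ite b e1 e2)) B) (l, R) (l + exp_len (Ite b e1 e2), R2)"
      by (rule reach_trans[OF reach_trans[OF R1(1) 2 order.refl]])
        (use R2 in \<open>auto simp: ac_simps\<close>)
    moreover have "R2 d = eval w A (Ite b e1 e2) s" using R1 R2 True by auto
    moreover have "\<forall>r. r < d \<or> q \<le> r \<longrightarrow> R2 r = R r" using R1 R2 True by auto
    ultimately show ?thesis by blast
  next
    case False
    have 2: "reach M w 1 (?l1, R1) (?l1 + 1, R1)" using reach_instr[OF c(2), of w R1] R1 False by simp
    obtain R2 where R2: "reach M w (poly (exp_time e2) B) (?l1 + 1, R1) (?l1 + 1 + exp_len e2, R2)"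
      "R2 d = eval w A e2 s" "\<forall>r. r < d \<or> q \<le> r \<longrightarrow> R2 r = R1 r"
      using Ite.IH(3)[of "?l1 + 1" d R1 s] Ite.prems rep c by auto
    let ?R3 = "R2(d + 1 := 1)"
    have 3: "reach M w 1 (?l2 + 1, R2) (?l2 + 2, ?R3)" using reach_instr[OF c(4)] by simp
    have 4: "reach M w 1 (?l2 + 2, ?R3) (?end, ?R3)" using reach_instr[OF c(5), of w ?R3] by simp
    have R2': "reach M w (poly (exp_time e2) B) (?l1 + 1, R1) (?l2 + 1, R2)"
      using R2(1) by (simp add: ac_simps)
    have "reach M w (poly (exp_time (Ite b e1 e2)) B) (l, R) (?end, ?R3)"
      by (rule reach_trans[OF reach_trans[OF reach_trans[OF reach_trans[OF
              R1(1) 2 order.refl] R2' order.refl] 3 order.refl] 4]) simp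
    then have "reach M w (poly (exp_time (Ite b e1 e2)) B) (l, R) (l + exp_len (Ite b e1 e2), ?R3)"
      by (simp add: ac_simps)
    moreover have "?R3 d = eval w A (Ite b e1 e2) s" using R1 R2 False Ite.prems by auto
    moreover have "\<forall>r. r < d \<or> q \<le> r \<longrightarrow> ?R3 r = R r" using R1 R2 False Ite.prems by auto
    ultimately show ?thesis by blast
  qed
next
  case (Sum x y e)
  let ?L = "exp_len e" let ?test = "l + ?L + 9" let ?n = "s y" let ?T = "poly (exp_time e) B"
  let ?init = "[Const d 0, Add (d + 1) x d, Add (d + 2) y d, Const x 0, Const (d + 3) 1]"
  let ?step = "[Add d d (d + 4), Add x x (d + 3), Sub (d + 2) (d + 2) (d + 3)]"
  have xy: "x < h" "y < h" "x < d" "y < d" "d + 4 < q" "exp_vars e \<subseteq> {..<h}"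
    using Sum.prems by (auto simp: Suc_le_eq[symmetric])
      (use Sum.prems(4) in \<open>cases e; simp\<close>)
  have nB: "?n \<le> B" using Sum.prems by simp
  have c: "code_at M l ?init" "code_at M (l + 5) [Jump_Pos (d + 3) ?test]"
    "code_at M (l + 6) (exp_code q (l + 6) (d + 4) e)" "code_at M (l + 6 + ?L) ?step"
    "code_at M ?test [Jump_Pos (d + 2) (l + 6)]" "code_at M (l + ?L + 10) [Add x (d + 1) (d + 2)]"
  proof -
    note 1 = code_at_append[OF Sum.prems(1)[unfolded exp_code.simps]]
    note 2 = code_at_append[OF 1[THEN conjunct2]]
    note 3 = code_at_append[OF 2[THEN conjunct2]]
    note 4 = code_at_append[OF 3[THEN conjunct2], unfolded length_exp_code]
    note 5 = code_at_append[OF 4[THEN conjunct2]]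
    show "code_at M l ?init" using 1 by blast
    show "code_at M (l + 5) [Jump_Pos (d + 3) ?test]" using 2 by (simp add: eval_nat_numeral)
    show "code_at M (l + 6) (exp_code q (l + 6) (d + 4) e)" using 3 by (simp add: eval_nat_numeral)
    show "code_at M (l + 6 + ?L) ?step" using 4 by (simp add: eval_nat_numeral)
    show "code_at M ?test [Jump_Pos (d + 2) (l + 6)]"
      "code_at M (l + ?L + 10) [Add x (d + 1) (d + 2)]" using 5 by (simp_all add: ac_simps eval_nat_numeral)
  qed
  have Rxy: "R x = s x" "R y = s y" using Sum.prems(2) xy by (auto simp: represents_def)
  let ?R1 = "effect w ?init R"
  have init: "reach M w 6 (l, R) (?test, ?R1)"
  proof (rule reach_trans)
    show "reach M w 5 (l, R) (l + 5, ?R1)" by (rule reach_straight[OF c(1)]) simp_all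
    show "reach M w 1 (l + 5, ?R1) (?test, ?R1)" using reach_instr[OF c(2), of w ?R1] xy by simp
  qed simp
  have loop: "\<exists>R'. reach M w (k * (?T + 4)) (?test, ?R1) (?test, R') \<and>
      R' d = (\<Sum>i<k. eval w A e (s(x := i))) \<and> R' (d + 1) = s x \<and> R' (d + 2) = ?n - k \<and>
      R' (d + 3) = 1 \<and> R' x = k \<and> (\<forall>r. r < d \<and> r \<noteq> x \<or> q \<le> r \<longrightarrow> R' r = R r)"
    if "k \<le> ?n" for k
    using that
  proof (induction k)
    case 0
    show ?case
      by (intro exI[of _ ?R1] conjI) (use xy Rxy in \<open>auto simp: reach_refl\<close>)
  next
    case (Suc k)
    then have "k \<le> ?n" by simp
    from Suc.IH[OF this] obtain R2 where R2: "reach M w (k * (?T + 4)) (?test, ?R1) (?test, R2)"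
      "R2 d = (\<Sum>i<k. eval w A e (s(x := i)))" "R2 (d + 1) = s x" "R2 (d + 2) = ?n - k"
      "R2 (d + 3) = 1" "R2 x = k" "\<forall>r. r < d \<and> r \<noteq> x \<or> q \<le> r \<longrightarrow> R2 r = R r" by blast
    have jump: "reach M w 1 (?test, R2) (l + 6, R2)"
      using reach_instr[OF c(5), of w R2] R2 Suc.prems by simp
    have "represents h q R2 (s(x := k)) A"
      using Sum.prems(2,3) R2 by (auto simp: represents_def)
    moreover have "k \<le> B" using Suc.prems nB by linarith
    then have "\<forall>z. (s(x := k)) z \<le> B" using Sum.prems(7) by simp
    moreover have "h \<le> d + 4" "d + 4 + exp_depth e \<le> q" "exp_arrays e \<subseteq> {..<4}"
      using Sum.prems by simp_all
    ultimately obtain R3 where R3: "reach M w ?T (l + 6, R2) (l + 6 + ?L, R3)"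
      "R3 (d + 4) = eval w A e (s(x := k))" "\<forall>r. r < d + 4 \<or> q \<le> r \<longrightarrow> R3 r = R2 r"
      using Sum.IH[OF c(3) _ _ _ xy(6)] by blast
    let ?R4 = "effect w ?step R3"
    have step: "reach M w 3 (l + 6 + ?L, R3) (?test, ?R4)"
      using reach_straight[OF c(4), of 3 w R3] by (simp add: ac_simps)
    have "reach M w (Suc k * (?T + 4)) (?test, ?R1) (?test, ?R4)"
      by (rule reach_trans[OF reach_trans[OF reach_trans[OF R2(1) jump order.refl] R3(1) order.refl] step])
        simp
    moreover have "?R4 d = (\<Sum>i<Suc k. eval w A e (s(x := i))) \<and> ?R4 (d + 1) = s x \<and>
      ?R4 (d + 2) = ?n - Suc k \<and> ?R4 (d + 3) = 1 \<and> ?R4 x = Suc k \<and>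
      (\<forall>r. r < d \<and> r \<noteq> x \<or> q \<le> r \<longrightarrow> ?R4 r = R r)"
      using R2 R3 xy Suc.prems by auto
    ultimately show ?case by blast
  qed
  obtain R2 where R2: "reach M w (?n * (?T + 4)) (?test, ?R1) (?test, R2)"
      "R2 d = (\<Sum>i<?n. eval w A e (s(x := i)))" "R2 (d + 1) = s x" "R2 (d + 2) = 0"
      "\<forall>r. r < d \<and> r \<noteq> x \<or> q \<le> r \<longrightarrow> R2 r = R r" using loop[of ?n] by auto
  let ?R3 = "R2(x := s x)"
  have 3: "reach M w 1 (?test, R2) (l + ?L + 10, R2)"
    using reach_instr[OF c(5), of w R2] R2 by (simp add: ac_simps)
  have 4: "reach M w 1 (l + ?L + 10, R2) (l + exp_len (Sum x y e), ?R3)"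
    using reach_instr[OF c(6), of w R2] R2 by (simp add: ac_simps)
  have "reach M w (poly (exp_time (Sum x y e)) B) (l, R) (l + exp_len (Sum x y e), ?R3)"
  proof (rule reach_trans[OF reach_trans[OF reach_trans[OF init R2(1) order.refl] 3 order.refl] 4])
    have "?n * (?T + 4) \<le> B * (?T + 4)" using nB by (rule mult_le_mono1)
    then show "6 + ?n * (?T + 4) + 1 + 1 \<le> poly (exp_time (Sum x y e)) B" by simp
  qed
  moreover have "\<forall>r. r < d \<or> q \<le> r \<longrightarrow> ?R3 r = R r" using R2 xy Rxy Sum.prems by auto
  moreover have "?R3 d = eval w A (Sum x y e) s" using R2 xy by auto
  ultimately show ?case by blast
qed

text \<open>A loop keeps its counter in the scratch register \<open>d\<close> and copies it to the loop variable at
the start of every iteration, so the body may overwrite the variable.\<close>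

lemma com_code_correct:
  assumes "code_at M l (com_code q l d c)" "represents h q R (fst \<sigma>) (snd \<sigma>)" "h \<le> d"
    "d + com_depth c \<le> q" "com_vars c \<subseteq> {..<h}" "com_arrays c \<subseteq> {..<4}" "bounded_run w B c \<sigma>"
  shows "\<exists>R'. reach M w (poly (com_time c) B) (l, R) (l + com_len c, R') \<and>
    represents h q R' (fst (sem w c \<sigma>)) (snd (sem w c \<sigma>)) \<and> (\<forall>r. h \<le> r \<and> r < d \<longrightarrow> R' r = R r)"
  using assms
proof (induction c arbitrary: l d R \<sigma>)
  case (Assign x e)
  let ?c = "[Const x 0, Add x x d]"
  have c: "code_at M l (exp_code q l d e)" "code_at M (l + exp_len e) ?c"
    using Assign.prems(1) by (auto dest!: code_at_append simp: length_exp_code)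
  obtain R1 where R1: "reach M w (poly (exp_time e) B) (l, R) (l + exp_len e, R1)"
    "R1 d = eval w (snd \<sigma>) e (fst \<sigma>)" "\<forall>r. r < d \<or> q \<le> r \<longrightarrow> R1 r = R r"
    using exp_code_correct[OF c(1), of h R "fst \<sigma>" "snd \<sigma>" B w] Assign.prems by auto
  have x: "x < h" "x < d" "x < q" using Assign.prems by auto
  have rep: "represents h q R1 (fst \<sigma>) (snd \<sigma>)"
    by (rule represents_cong[OF Assign.prems(2)]) (use R1 Assign.prems in auto)
  have "reach M w (poly (com_time (Assign x e)) B) (l, R) (l + com_len (Assign x e), effect w ?c R1)"
    by (rule reach_trans[OF R1(1)]) (use reach_straight[OF c(2), of 2 w R1] in \<open>auto simp: add.assoc\<close>)
  moreover have "represents h q (effect w ?c R1) (fst (sem w (Assign x e) \<sigma>)) (snd (sem w (Assign x e) \<sigma>))"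
    using rep x R1 by (auto simp: represents_def)
  moreover have "\<forall>r. h \<le> r \<and> r < d \<longrightarrow> effect w ?c R1 r = R r" using R1 x by auto
  ultimately show ?case by blast
next
  case (Update a i e)
  let ?c = "[Add d d d, Add d d d, Const (d + 2) (q + a), Add d d (d + 2), Store d (d + 1)]"
  let ?s = "fst \<sigma>" let ?A = "snd \<sigma>"
  have c: "code_at M l (exp_code q l d i)"
    "code_at M (l + exp_len i) (exp_code q (l + exp_len i) (d + 1) e)"
    "code_at M (l + exp_len i + exp_len e) ?c"
    using Update.prems(1) by (auto dest!: code_at_append simp: length_exp_code add.assoc)
  obtain R1 where R1: "reach M w (poly (exp_time i) B) (l, R) (l + exp_len i, R1)"
    "R1 d = eval w ?A i ?s" "\<forall>r. r < d \<or> q \<le> r \<longrightarrow> R1 r = R r"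
    using exp_code_correct[OF c(1), of h R ?s ?A B w] Update.prems by auto
  have rep: "represents h q R1 ?s ?A"
    by (rule represents_cong[OF Update.prems(2)]) (use R1 Update.prems in auto)
  obtain R2 where R2: "reach M w (poly (exp_time e) B) (l + exp_len i, R1) (l + exp_len i + exp_len e, R2)"
    "R2 (d + 1) = eval w ?A e ?s" "\<forall>r. r < d + 1 \<or> q \<le> r \<longrightarrow> R2 r = R1 r"
    using exp_code_correct[OF c(2), of h R1 ?s ?A B w] Update.prems rep by auto
  have rep2: "represents h q R2 ?s ?A"
    by (rule represents_cong[OF rep]) (use R2 Update.prems in auto)
  have 3: "reach M w 5 (l + exp_len i + exp_len e, R2) (l + exp_len i + exp_len e + 5, effect w ?c R2)"
    by (rule reach_straight[OF c(3)]) simp_all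
  have "reach M w (poly (com_time (Update a i e)) B) (l, R) (l + com_len (Update a i e), effect w ?c R2)"
    using reach_trans[OF reach_trans[OF R1(1) R2(1) order.refl] 3 order.refl] by (simp add: add.assoc)
  moreover have "effect w ?c R2 = R2(d := q + 4 * eval w ?A i ?s + a, d + 2 := q + a,
      q + 4 * eval w ?A i ?s + a := eval w ?A e ?s)"
    using R1 R2 by (auto simp: fun_eq_iff algebra_simps)
  moreover have "represents h q (R2(d := q + 4 * eval w ?A i ?s + a, d + 2 := q + a,
      q + 4 * eval w ?A i ?s + a := eval w ?A e ?s)) (fst (sem w (Update a i e) \<sigma>)) (snd (sem w (Update a i e) \<sigma>))"
  proof -
    have "a < 4" "d + 2 < q" "h \<le> d" using Update.prems by auto
    moreover have "q + 4 * j + b = q + 4 * k + a \<longleftrightarrow> j = k \<and> b = a" if "b < 4" for j k b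
      using that \<open>a < 4\<close> by presburger
    ultimately show ?thesis using rep2 by (auto simp: represents_def)
  qed
  moreover have "\<forall>r. h \<le> r \<and> r < d \<longrightarrow> (R2(d := q + 4 * eval w ?A i ?s + a, d + 2 := q + a,
      q + 4 * eval w ?A i ?s + a := eval w ?A e ?s)) r = R r"
    using R1 R2 Update.prems by auto
  ultimately show ?case by metis
next
  case (Seq c1 c2)
  have c: "code_at M l (com_code q l d c1)" "code_at M (l + com_len c1) (com_code q (l + com_len c1) d c2)"
    using Seq.prems(1) by (auto dest!: code_at_append simp: length_com_code)
  obtain R1 where R1: "reach M w (poly (com_time c1) B) (l, R) (l + com_len c1, R1)"
    "represents h q R1 (fst (sem w c1 \<sigma>)) (snd (sem w c1 \<sigma>))" "\<forall>r. h \<le> r \<and> r < d \<longrightarrow> R1 r = R r"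
    using Seq.IH(1)[of l d R \<sigma>] Seq.prems c by auto
  obtain R2 where R2: "reach M w (poly (com_time c2) B) (l + com_len c1, R1) (l + com_len c1 + com_len c2, R2)"
    "represents h q R2 (fst (sem w c2 (sem w c1 \<sigma>))) (snd (sem w c2 (sem w c1 \<sigma>)))"
    "\<forall>r. h \<le> r \<and> r < d \<longrightarrow> R2 r = R1 r"
    using Seq.IH(2)[of "l + com_len c1" d R1 "sem w c1 \<sigma>"] Seq.prems c R1 by auto
  have "reach M w (poly (com_time (Seq c1 c2)) B) (l, R) (l + com_len (Seq c1 c2), R2)"
    using reach_trans[OF R1(1) R2(1) order.refl] by (simp add: add.assoc)
  moreover have "represents h q R2 (fst (sem w (Seq c1 c2) \<sigma>)) (snd (sem w (Seq c1 c2) \<sigma>))"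
    using R2 by simp
  moreover have "\<forall>r. h \<le> r \<and> r < d \<longrightarrow> R2 r = R r" using R1 R2 by simp
  ultimately show ?case by blast
next
  case (For x y c)
  let ?L = "com_len c" let ?test = "l + ?L + 8" let ?n = "fst \<sigma> y" let ?T = "poly (com_time c) B"
  let ?it = "\<lambda>k. iterate (\<lambda>i \<tau>. sem w c ((fst \<tau>)(x := i), snd \<tau>)) k \<sigma>"
  let ?init = "[Const d 0, Add (d + 1) y d, Const (d + 2) 1]"
  let ?set = "[Const x 0, Add x x d]"
  let ?step = "[Add d d (d + 2), Sub (d + 1) (d + 1) (d + 2)]"
  have xy: "x < h" "y < h" "x < d" "y < d" "d + 3 \<le> q" "com_vars c \<subseteq> {..<h}"
    using For.prems by auto
  have nB: "?n \<le> B" using For.prems by simp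
  have c: "code_at M l ?init" "code_at M (l + 3) [Jump_Pos (d + 2) ?test]" "code_at M (l + 4) ?set"
    "code_at M (l + 6) (com_code q (l + 6) (d + 3) c)" "code_at M (l + 6 + ?L) ?step"
    "code_at M ?test [Jump_Pos (d + 1) (l + 4)]"
  proof -
    note 1 = code_at_append[OF For.prems(1)[unfolded com_code.simps]]
    note 2 = code_at_append[OF 1[THEN conjunct2]]
    note 3 = code_at_append[OF 2[THEN conjunct2]]
    note 4 = code_at_append[OF 3[THEN conjunct2]]
    note 5 = code_at_append[OF 4[THEN conjunct2], unfolded length_com_code]
    show "code_at M l ?init" using 1 by blast
    show "code_at M (l + 3) [Jump_Pos (d + 2) ?test]" using 2 by (simp add: eval_nat_numeral)
    show "code_at M (l + 4) ?set" using 3 by (simp add: eval_nat_numeral)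
    show "code_at M (l + 6) (com_code q (l + 6) (d + 3) c)" using 4 by (simp add: eval_nat_numeral)
    show "code_at M (l + 6 + ?L) ?step" using 5 by (simp add: eval_nat_numeral)
    show "code_at M ?test [Jump_Pos (d + 1) (l + 4)]" using 5 by (simp_all add: ac_simps eval_nat_numeral)
  qed
  have Ry: "R y = ?n" using For.prems(2) xy by (auto simp: represents_def)
  let ?R1 = "effect w ?init R"
  have init: "reach M w 4 (l, R) (?test, ?R1)"
  proof (rule reach_trans)
    show "reach M w 3 (l, R) (l + 3, ?R1)" by (rule reach_straight[OF c(1)]) simp_all
    show "reach M w 1 (l + 3, ?R1) (?test, ?R1)" using reach_instr[OF c(2), of w ?R1] by simp
  qed simp
  have loop: "\<exists>R'. reach M w (k * (?T + 5)) (?test, ?R1) (?test, R') \<and>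
      R' d = k \<and> R' (d + 1) = ?n - k \<and> R' (d + 2) = 1 \<and>
      represents h q R' (fst (?it k)) (snd (?it k)) \<and> (\<forall>r. h \<le> r \<and> r < d \<longrightarrow> R' r = R r)"
    if "k \<le> ?n" for k
    using that
  proof (induction k)
    case 0
    have "represents h q ?R1 (fst \<sigma>) (snd \<sigma>)"
      by (rule represents_cong[OF For.prems(2)]) (use xy For.prems in auto)
    moreover have "?R1 d = 0" "?R1 (d + 1) = ?n - 0" "?R1 (d + 2) = 1"
      "\<forall>r. h \<le> r \<and> r < d \<longrightarrow> ?R1 r = R r" using xy Ry by auto
    ultimately show ?case using reach_refl[of M w "0 * (?T + 5)" "(?test, ?R1)"]
      unfolding iterate.simps by blast
  next
    case (Suc k)
    then have "k \<le> ?n" by simp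
    from Suc.IH[OF this] obtain R2 where R2: "reach M w (k * (?T + 5)) (?test, ?R1) (?test, R2)"
      "R2 d = k" "R2 (d + 1) = ?n - k" "R2 (d + 2) = 1"
      "represents h q R2 (fst (?it k)) (snd (?it k))" "\<forall>r. h \<le> r \<and> r < d \<longrightarrow> R2 r = R r" by blast
    let ?\<tau> = "((fst (?it k))(x := k), snd (?it k))" let ?R3 = "R2(x := k)"
    have jump: "reach M w 1 (?test, R2) (l + 4, R2)"
      using reach_instr[OF c(6), of w R2] R2 Suc.prems by simp
    have "effect w ?set R2 = ?R3" using R2 xy by simp
    then have set: "reach M w 2 (l + 4, R2) (l + 6, ?R3)"
      using reach_straight[OF c(3), of 2 w R2] by (simp add: ac_simps)
    have rep: "represents h q ?R3 (fst ?\<tau>) (snd ?\<tau>)"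
      using R2(5) xy For.prems(3) by (auto simp: represents_def)
    have "bounded_run w B c ?\<tau>" using For.prems(7) Suc.prems by (simp add: Let_def)
    moreover have "h \<le> d + 3" "d + 3 + com_depth c \<le> q" "com_arrays c \<subseteq> {..<4}"
      using For.prems by simp_all
    ultimately obtain R4 where R4: "reach M w ?T (l + 6, ?R3) (l + 6 + ?L, R4)"
      "represents h q R4 (fst (sem w c ?\<tau>)) (snd (sem w c ?\<tau>))"
      "\<forall>r. h \<le> r \<and> r < d + 3 \<longrightarrow> R4 r = ?R3 r"
      using For.IH[OF c(4) rep _ _ xy(6)] by blast
    let ?R5 = "effect w ?step R4"
    have step: "reach M w 2 (l + 6 + ?L, R4) (?test, ?R5)"
      using reach_straight[OF c(5), of 2 w R4] by (simp add: ac_simps)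
    have "reach M w (Suc k * (?T + 5)) (?test, ?R1) (?test, ?R5)"
      by (rule reach_trans[OF reach_trans[OF reach_trans[OF reach_trans[OF
              R2(1) jump order.refl] set order.refl] R4(1) order.refl] step]) simp
    moreover have "represents h q ?R5 (fst (sem w c ?\<tau>)) (snd (sem w c ?\<tau>))"
      by (rule represents_cong[OF R4(2)]) (use xy For.prems(3) in auto)
    moreover have "?R5 d = Suc k" "?R5 (d + 1) = ?n - Suc k" "?R5 (d + 2) = 1"
      "\<forall>r. h \<le> r \<and> r < d \<longrightarrow> ?R5 r = R r"
      using R2 R4 xy For.prems(3) by auto
    ultimately show ?case unfolding iterate.simps by blast
  qed
  obtain R2 where R2: "reach M w (?n * (?T + 5)) (?test, ?R1) (?test, R2)" "R2 (d + 1) = 0"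
      "represents h q R2 (fst (?it ?n)) (snd (?it ?n))" "\<forall>r. h \<le> r \<and> r < d \<longrightarrow> R2 r = R r"
    using loop[of ?n] by auto
  have 3: "reach M w 1 (?test, R2) (l + com_len (For x y c), R2)"
    using reach_instr[OF c(6), of w R2] R2 by (simp add: ac_simps)
  have "reach M w (poly (com_time (For x y c)) B) (l, R) (l + com_len (For x y c), R2)"
  proof (rule reach_trans[OF reach_trans[OF init R2(1) order.refl] 3])
    have "?n * (?T + 5) \<le> B * (?T + 5)" using nB by (rule mult_le_mono1)
    then show "4 + ?n * (?T + 5) + 1 \<le> poly (com_time (For x y c)) B" by simp
  qed
  moreover have "represents h q R2 (fst (sem w (For x y c) \<sigma>)) (snd (sem w (For x y c) \<sigma>))"
    using R2 by simp
  ultimately show ?case using R2(4) by blast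
qed

definition compile :: "com \<Rightarrow> instr list" where
  "compile c = (let h = Suc (Max (insert 0 (com_vars c))) in com_code (h + com_depth c) 0 h c)"

lemma finite_exp_vars: "finite (exp_vars e)"
  by (induction e) auto

lemma finite_com_vars: "finite (com_vars c)"
  by (induction c) (auto simp: finite_exp_vars)

lemma compile_decides:
  assumes arr: "com_arrays c \<subseteq> {..<4}"
    and run: "bounded_run w B c (\<lambda>_. 0, \<lambda>_ _. 0)"
    and T: "poly (com_time c) B \<le> T"
    and res: "fst (sem w c (\<lambda>_. 0, \<lambda>_ _. 0)) 0 \<noteq> 0 \<longleftrightarrow> b"
  shows "ram_decides (compile c) w T b"
proof -
  define h where "h = Suc (Max (insert 0 (com_vars c)))"
  let ?q = "h + com_depth c"
  let ?M = "com_code ?q 0 h c"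
  have M: "compile c = ?M" by (simp add: compile_def h_def Let_def)
  have "x < h" if "x \<in> com_vars c" for x
    unfolding h_def using that finite_com_vars by (auto simp: less_Suc_eq_le intro: Max_ge)
  then have vars: "com_vars c \<subseteq> {..<h}" by auto
  have "\<exists>R'. reach ?M w (poly (com_time c) B) (0, \<lambda>_. 0) (0 + com_len c, R') \<and>
    represents h ?q R' (fst (sem w c (\<lambda>_. 0, \<lambda>_ _. 0))) (snd (sem w c (\<lambda>_. 0, \<lambda>_ _. 0))) \<and>
    (\<forall>r. h \<le> r \<and> r < h \<longrightarrow> R' r = 0)"
    using arr run vars by (intro com_code_correct) (auto simp: code_at_def represents_def)
  then obtain R' where R': "reach ?M w (poly (com_time c) B) (0, \<lambda>_. 0) (com_len c, R')"
    "represents h ?q R' (fst (sem w c (\<lambda>_. 0, \<lambda>_ _. 0))) (snd (sem w c (\<lambda>_. 0, \<lambda>_ _. 0)))" by auto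
  obtain t where t: "t \<le> poly (com_time c) B" "(ram_step ?M w ^^ t) (0, \<lambda>_. 0) = (com_len c, R')"
    using R'(1) by (auto simp: reach_def)
  have "(ram_step ?M w ^^ k) (com_len c, R') = (com_len c, R')" for k
    by (induction k) (auto simp: ram_step_def length_com_code)
  then have "(ram_step ?M w ^^ (T - t + t)) (0, \<lambda>_. 0) = (com_len c, R')"
    unfolding funpow_add by (simp add: t(2))
  then have "(ram_step ?M w ^^ T) (0, \<lambda>_. 0) = (com_len c, R')" using t(1) T by simp
  moreover have "R' 0 = fst (sem w c (\<lambda>_. 0, \<lambda>_ _. 0)) 0"
    using R'(2) by (auto simp: represents_def h_def)
  ultimately show ?thesis using res unfolding ram_decides_def M by (simp add: length_com_code)
qed

section \<open>Encoded graphs\<close>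

definition graph_iso :: "('v \<Rightarrow> 'u) \<Rightarrow> ('e \<Rightarrow> 'd) \<Rightarrow> ('v, 'e) mgraph \<Rightarrow> ('u, 'd) mgraph \<Rightarrow> bool" where
  "graph_iso f g G H \<longleftrightarrow> bij_betw f (verts G) (verts H) \<and> bij_betw g (edges G) (edges H) \<and>
     (\<forall>e\<in>edges G. ends H (g e) = f ` ends G e)"

lemma graph_iso_inverse:
  assumes iso: "graph_iso f g G H" and G: "multigraph G"
  shows "graph_iso (inv_into (verts G) f) (inv_into (edges G) g) H G"
proof -
  have f: "bij_betw f (verts G) (verts H)" and g: "bij_betw g (edges G) (edges H)"
    and e: "\<And>e. e \<in> edges G \<Longrightarrow> ends H (g e) = f ` ends G e"
    using iso by (auto simp: graph_iso_def)
  have "ends G (inv_into (edges G) g d) = inv_into (verts G) f ` ends H d" if d: "d \<in> edges H" for d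
  proof -
    have "inv_into (edges G) g d \<in> edges G" and gd: "g (inv_into (edges G) g d) = d"
      using g d by (auto simp: bij_betw_def inv_into_into f_inv_into_f)
    moreover from this have "ends G (inv_into (edges G) g d) \<subseteq> verts G"
      using G by (auto simp: multigraph_def)
    ultimately show ?thesis
      using e[of "inv_into (edges G) g d"] f by (simp add: bij_betw_def inv_into_image_cancel)
  qed
  then show ?thesis using f g by (auto simp: graph_iso_def bij_betw_inv_into)
qed

lemma graph_iso_inside:
  assumes iso: "graph_iso f g G H" and G: "multigraph G" and X: "X \<subseteq> verts G"
  shows "card (inside H (f ` X)) = card (inside G X)"
proof -
  have f: "inj_on f (verts G)" and g: "inj_on g (edges G)" "edges H = g ` edges G"
    and e: "\<And>e. e \<in> edges G \<Longrightarrow> ends H (g e) = f ` ends G e"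
    using iso by (auto simp: graph_iso_def bij_betw_def)
  have key: "ends H (g e) \<subseteq> f ` X \<longleftrightarrow> ends G e \<subseteq> X" if "e \<in> edges G" for e
    unfolding e[OF that]
  proof
    assume "f ` ends G e \<subseteq> f ` X"
    moreover have "ends G e \<subseteq> verts G" using that G by (auto simp: multigraph_def)
    ultimately show "ends G e \<subseteq> X" using f X by (auto simp: inj_on_def) (metis image_iff subsetD)
  qed auto
  have "inside H (f ` X) = g ` {e \<in> edges G. ends H (g e) \<subseteq> f ` X}"
    unfolding inside_def g(2) by blast
  also have "{e \<in> edges G. ends H (g e) \<subseteq> f ` X} = inside G X"
    unfolding inside_def by (intro Collect_cong conj_cong refl) (rule key)
  finally have "inside H (f ` X) = g ` inside G X" .
  moreover have "inj_on g (inside G X)" using g by (auto simp: inside_def intro: inj_on_subset)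
  ultimately show ?thesis by (simp add: card_image)
qed

lemma graph_iso_sparse:
  assumes iso: "graph_iso f g G H" and G: "sparse_graph G"
  shows "sparse_graph H"
proof -
  interpret G: sparse_graph G by (rule G)
  have f: "inj_on f (verts G)" "verts H = f ` verts G" and g: "inj_on g (edges G)" "edges H = g ` edges G"
    and e: "\<And>e. e \<in> edges G \<Longrightarrow> ends H (g e) = f ` ends G e"
    using iso by (auto simp: graph_iso_def bij_betw_def)
  have card_f: "card (f ` X) = card X" if "X \<subseteq> verts G" for X
    using f(1) that by (meson card_image inj_on_subset)
  show ?thesis
  proof
    have "finite (verts H)" "finite (edges H)" using G.finite_verts G.finite_edges f g by simp_all
    moreover have "ends H (g e) \<subseteq> verts H \<and> card (ends H (g e)) = 2" if "e \<in> edges G" for e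
      using that e card_f G.ends_verts G.card_ends f(2) by (simp add: image_mono)
    ultimately show "multigraph H" using g(2) by (auto simp: multigraph_def)
    show "verts H \<noteq> {}" using G.verts_nonempty f by simp
    show "card (edges H) + 2 = 2 * card (verts H)"
      using G.edge_count f g by (simp add: card_image)
    fix Y assume Y: "Y \<subseteq> verts H" "Y \<noteq> {}"
    then obtain X where X: "X \<subseteq> verts G" "Y = f ` X" using f(2) by (auto simp: subset_image_iff)
    then show "card (inside H Y) + 2 \<le> 2 * card Y"
      using G.sparse[OF X(1)] Y card_f graph_iso_inside[OF iso G.multigraph X(1)] by auto
  qed
qed

lemma graph_iso_decomposition:
  assumes iso: "graph_iso f g G H" and G: "sparse_graph G" and P: "circuit_decomposition G P"
  shows "circuit_decomposition H ((`) f ` P)"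
proof -
  interpret G: sparse_graph G by (rule G)
  interpret H: sparse_graph H by (rule graph_iso_sparse[OF iso G])
  have f: "inj_on f (verts G)" "verts H = f ` verts G"
    using iso by (auto simp: graph_iso_def bij_betw_def)
  have card_f: "card (f ` X) = card X" if "X \<subseteq> verts G" for X
    using f(1) that by (meson card_image inj_on_subset)
  have tight: "H.tight (f ` X) \<longleftrightarrow> G.tight X" if "X \<subseteq> verts G" for X
    using that f card_f[OF that] graph_iso_inside[OF iso G.multigraph that]
    by (auto simp: G.tight_def H.tight_def)
  have part: "partition_on (verts G) P" and circ: "\<And>X. X \<in> P \<Longrightarrow> G.circuit X"
    using P by (auto simp: G.circuit_decomposition_iff)
  have "H.circuit (f ` X)" if X: "X \<in> P" for X
  proof -
    have c: "G.circuit X" by (rule circ[OF X])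
    then have XV: "X \<subseteq> verts G" by (simp add: G.circuit_def G.tight_def)
    have "Y = f ` X" if Y: "H.tight Y" "2 \<le> card Y" "Y \<subseteq> f ` X" for Y
    proof -
      obtain Z where Z: "Z \<subseteq> X" "Y = f ` Z" using Y(3) by (auto simp: subset_image_iff)
      then have "Z \<subseteq> verts G" using XV by simp
      then have "Z = X" using c Z Y tight card_f by (auto simp: G.circuit_def)
      then show ?thesis using Z by simp
    qed
    then show ?thesis using c tight[OF XV] card_f[OF XV] by (auto simp: G.circuit_def H.circuit_def)
  qed
  moreover have "partition_on (f ` verts G) ((`) f ` P - {{}})"
    by (rule partition_on_inj_image[OF part f(1)])
  moreover have "(`) f ` P - {{}} = (`) f ` P" using partition_onD3[OF part] by auto
  ultimately show ?thesis using f(2) by (auto simp: H.circuit_decomposition_iff)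
qed

definition input :: "nat list \<Rightarrow> nat \<Rightarrow> nat" where
  "input w i = (if i < length w then w ! i else 0)"

definition tail :: "nat list \<Rightarrow> nat \<Rightarrow> nat" where
  "tail w e = input w (2 + (e + e))"

definition head :: "nat list \<Rightarrow> nat \<Rightarrow> nat" where
  "head w e = input w (3 + (e + e))"

text \<open>An encoding describes a graph up to isomorphism. The algorithm works on this
representative, whose edges are the positions in the edge list.\<close>

definition coded_graph :: "nat list \<Rightarrow> (nat, nat) mgraph" where
  "coded_graph w = \<lparr>verts = {..<input w 0}, edges = {..<input w 1}, ends = \<lambda>e. {tail w e, head w e}\<rparr>"

lemma length_concat_pairs: "length (concat (map (\<lambda>(a, b). [a, b]) ps)) = length ps + length ps"
  by (induction ps) auto

lemma nth_concat_pairs: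
  "i < length ps \<Longrightarrow> concat (map (\<lambda>(a, b). [a, b]) ps) ! (i + i) = fst (ps ! i) \<and>
    concat (map (\<lambda>(a, b). [a, b]) ps) ! Suc (i + i) = snd (ps ! i)"
proof (induction ps arbitrary: i)
  case (Cons p ps)
  then show ?case by (cases i) (auto split: prod.splits)
qed simp

text \<open>The edge isomorphism sends an edge to its position in the list.\<close>

lemma coded_graph_iso:
  assumes code: "graph_code G w"
  shows "\<exists>f g. graph_iso f g G (coded_graph w)"
    and "input w 0 = card (verts G)" and "input w 1 = card (edges G)"
proof -
  obtain f es ps where f: "bij_betw f (verts G) {..<card (verts G)}"
    and es: "distinct es" "set es = edges G"
    and ps: "list_all2 (\<lambda>e (a, b). f ` ends G e = {a, b}) es ps"
    and w: "w = card (verts G) # card (edges G) # concat (map (\<lambda>(a, b). [a, b]) ps)"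
    using code unfolding graph_code_def by (elim exE conjE) (rule that)
  show n: "input w 0 = card (verts G)" and m: "input w 1 = card (edges G)"
    by (simp_all add: input_def w)
  have len: "length es = card (edges G)" "length ps = card (edges G)"
    using distinct_card[OF es(1)] es(2) list_all2_lengthD[OF ps] by simp_all
  let ?h = "\<lambda>i. es ! i"
  have h: "bij_betw ?h {..<card (edges G)} (edges G)"
    using bij_betw_nth[OF es(1)] es(2) len by simp
  have pair: "f ` ends G (es ! i) = {tail w i, head w i}" if i: "i < card (edges G)" for i
  proof -
    have "f ` ends G (es ! i) = {fst (ps ! i), snd (ps ! i)}"
      using list_all2_nthD[OF ps, of i] i len by (auto split: prod.splits)
    moreover have "w ! (2 + k) = concat (map (\<lambda>(a, b). [a, b]) ps) ! k"
      "w ! (3 + k) = concat (map (\<lambda>(a, b). [a, b]) ps) ! Suc k" for k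
      by (simp_all add: w numeral_3_eq_3)
    from this[of "i + i"] have "w ! (2 + (i + i)) = fst (ps ! i)" "w ! (3 + (i + i)) = snd (ps ! i)"
      using nth_concat_pairs[of i ps] i unfolding len(2) by presburger+
    moreover have "length w = 2 + (card (edges G) + card (edges G))"
      using length_concat_pairs[of ps] len by (simp add: w)
    then have "3 + (i + i) < length w" "2 + (i + i) < length w" using i by simp_all
    ultimately show ?thesis unfolding tail_def head_def input_def by presburger
  qed
  have "graph_iso f (inv_into {..<card (edges G)} ?h) G (coded_graph w)"
  proof -
    have "ends (coded_graph w) (inv_into {..<card (edges G)} ?h e) = f ` ends G e"
      if e: "e \<in> edges G" for e
    proof -
      obtain i where i: "i < card (edges G)" "e = es ! i"
        using e in_set_conv_nth[of e es] unfolding es(2) len(1) by auto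
      then have "inv_into {..<card (edges G)} ?h e = i"
        using h by (simp add: bij_betw_def inv_into_f_f)
      then show ?thesis using pair[OF i(1)] i by (simp add: coded_graph_def)
    qed
    then show ?thesis
      using f bij_betw_inv_into[OF h] n m by (simp add: graph_iso_def coded_graph_def)
  qed
  then show "\<exists>f g. graph_iso f g G (coded_graph w)" by blast
qed

lemma coded_graph_decomposition:
  assumes G: "sparse_graph G" and code: "graph_code G w"
  shows "sparse_graph (coded_graph w)"
    and "(\<exists>P. circuit_decomposition (coded_graph w) P) \<longleftrightarrow> (\<exists>P. circuit_decomposition G P)"
proof -
  obtain f g where iso: "graph_iso f g G (coded_graph w)" using coded_graph_iso[OF code] by blast
  have mg: "multigraph G" using G by (simp add: sparse_graph.multigraph)
  show C: "sparse_graph (coded_graph w)" by (rule graph_iso_sparse[OF iso G])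
  show "(\<exists>P. circuit_decomposition (coded_graph w) P) \<longleftrightarrow> (\<exists>P. circuit_decomposition G P)"
    using graph_iso_decomposition[OF iso G] graph_iso_decomposition[OF graph_iso_inverse[OF iso mg] C]
    by blast
qed

section \<open>The decision procedure as a program\<close>

text \<open>Conditions are expressions, true when positive. The variable 20 is reserved for
multiplication by repeated addition. Below, variable 1 holds the number of vertices, 2 the
number of edges, 3 and 4 the constants \<open>D\<close> and \<open>M\<close> of the balancing procedure, 5 the sum of all
loads, 6 the number of sweeps, 7 the edge under consideration and 0 the answer; 8 to 11 are loop
variables. Array 0 holds the distribution of the units of the edges, array 1 the characteristic
functions of the hulls and array 2 marks the edges that represent remaining circuits.\<close>

definition "Less a b = Minus b a"
definition "Conj a b = Ite a b (Num 0)"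
definition "Neg a = Ite a (Num 0) (Num 1)"
definition "Equal a b = Conj (Neg (Minus a b)) (Neg (Minus b a))"
definition "Times x y = Sum 20 x (Var y)"
definition "Tail e = Inp (Plus (Num 2) (Plus e e))"
definition "Head e = Inp (Plus (Num 3) (Plus e e))"

definition holds :: "nat list \<Rightarrow> arrays \<Rightarrow> exp \<Rightarrow> env \<Rightarrow> bool" where
  "holds w A e s \<longleftrightarrow> 0 < eval w A e s"

lemma eval_Tail [simp]: "eval w A (Tail e) s = tail w (eval w A e s)"
  by (simp add: Tail_def tail_def input_def)

lemma eval_Head [simp]: "eval w A (Head e) s = head w (eval w A e s)"
  by (simp add: Head_def head_def input_def)

lemma eval_Times [simp]: "x \<noteq> 20 \<Longrightarrow> y \<noteq> 20 \<Longrightarrow> eval w A (Times x y) s = s x * s y"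
  by (simp add: Times_def)

lemma eval_Less [simp]: "eval w A (Less a b) s = eval w A b s - eval w A a s"
  by (simp add: Less_def)

lemma eval_Ite [simp]: "eval w A (Ite b c d) s = (if holds w A b s then eval w A c s else eval w A d s)"
  by (simp add: holds_def)

declare eval.simps(7)[simp del]

lemma eval_Conj: "eval w A (Conj a b) s = (if holds w A a s then eval w A b s else 0)"
  by (simp add: Conj_def)

lemma eval_Neg: "eval w A (Neg a) s = (if holds w A a s then 0 else 1)"
  by (simp add: Neg_def)

lemma holds_simps [simp]:
  "holds w A (Conj a b) s \<longleftrightarrow> holds w A a s \<and> holds w A b s"
  "holds w A (Neg a) s \<longleftrightarrow> \<not> holds w A a s"
  "holds w A (Less a b) s \<longleftrightarrow> eval w A a s < eval w A b s"
  "holds w A (Equal a b) s \<longleftrightarrow> eval w A a s = eval w A b s"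
  "holds w A (Sum x y e) s \<longleftrightarrow> (\<exists>i<s y. holds w A e (s(x := i)))"
  "holds w A (Arr k e) s \<longleftrightarrow> A k (eval w A e s) \<noteq> 0"
  by (auto simp: holds_def eval_Conj eval_Neg Equal_def sum_eq_0_iff Bex_def intro: ccontr)

text \<open>The load of the vertex denoted by \<open>v\<close> when the edge in variable 7 supplies \<open>r\<close> and \<open>s\<close>. As
11 is the summation variable, it must not occur in \<open>v\<close>.\<close>

definition Load_of :: "exp \<Rightarrow> exp" where
  "Load_of v = Plus
     (Plus (Ite (Equal v (Tail (Var 7))) (Plus (Var 4) (Var 4)) (Num 0))
           (Ite (Equal v (Head (Var 7))) (Var 3) (Num 0)))
     (Sum 11 2 (Plus (Ite (Equal (Tail (Var 11)) v) (Arr 0 (Var 11)) (Num 0))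
                     (Ite (Equal (Head (Var 11)) v) (Minus (Var 4) (Arr 0 (Var 11))) (Num 0))))"

definition Rebalance :: com where
  "Rebalance = Update 0 (Var 9)
     (Ite (Conj (Less (Arr 0 (Var 9)) (Var 4))
                (Less (Plus (Load_of (Tail (Var 9))) (Num 1)) (Load_of (Head (Var 9)))))
        (Plus (Arr 0 (Var 9)) (Num 1))
        (Ite (Conj (Arr 0 (Var 9))
                   (Less (Plus (Load_of (Head (Var 9))) (Num 1)) (Load_of (Tail (Var 9)))))
           (Minus (Arr 0 (Var 9)) (Num 1))
           (Arr 0 (Var 9))))"

text \<open>All units of an edge start at its second end. Row \<open>e\<close> of the table in array 1 starts at
index \<open>e n\<close>.\<close>

definition Hulls :: com where
  "Hulls = For 7 2 (Seq (For 9 2 (Update 0 (Var 9) (Num 0)))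
     (Seq (For 8 6 (For 9 2 Rebalance))
       (For 10 1 (Update 1 (Plus (Times 7 1) (Var 10))
          (Less (Plus (Plus (Var 4) (Var 4)) (Var 1)) (Load_of (Var 10)))))))"

definition "Member v e = Arr 1 (Plus (Times e 1) v)"

definition Minimal :: exp where
  "Minimal = Neg (Sum 9 2 (Conj (Conj (Member (Tail (Var 9)) 7) (Member (Head (Var 9)) 7))
     (Sum 10 1 (Conj (Member (Var 10) 7) (Neg (Member (Var 10) 9))))))"

definition Removable :: exp where
  "Removable = Sum 10 1 (Conj (Neg (Member (Var 10) 7))
     (Neg (Sum 9 2 (Conj (Conj (Arr 2 (Var 9)) (Member (Var 10) 9))
        (Neg (Sum 11 1 (Conj (Member (Var 11) 9) (Member (Var 11) 7))))))))"

text \<open>One sweep per edge suffices, since every sweep that changes anything unmarks an edge.\<close>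

definition Eliminate :: com where
  "Eliminate = Seq (For 7 2 (Update 2 (Var 7) Minimal))
     (For 8 2 (For 7 2 (Update 2 (Var 7) (Conj (Arr 2 (Var 7)) (Neg Removable)))))"

definition Constants :: com where
  "Constants = Seq (Assign 1 (Inp (Num 0))) (Seq (Assign 2 (Inp (Num 1)))
     (Seq (Assign 3 (Plus (Plus (Times 1 1) (Times 1 1)) (Num 1))) (Seq (Assign 4 (Plus (Var 3) (Num 1)))
     (Seq (Assign 5 (Plus (Plus (Times 2 4) (Plus (Var 4) (Var 4))) (Var 3))) (Assign 6 (Times 5 5))))))"

definition Answer :: com where
  "Answer = Assign 0 (Neg (Sum 10 1 (Neg (Sum 9 2 (Conj (Arr 2 (Var 9)) (Member (Var 10) 9))))))"

definition Decide :: com where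
  "Decide = Seq Constants (Seq (Seq Hulls Eliminate) Answer)"

lemma sem_For_invariant:
  assumes "I 0 \<sigma>"
    and "\<And>i \<tau>. i < fst \<sigma> y \<Longrightarrow> I i \<tau> \<Longrightarrow> I (Suc i) (sem w c ((fst \<tau>)(x := i), snd \<tau>))"
  shows "I (fst \<sigma> y) (sem w (For x y c) \<sigma>)"
  unfolding sem.simps by (rule iterate_invariant) (use assms in auto)

lemma eval_Load_of:
  assumes v: "\<And>i. eval w A v (s(11 := i)) = eval w A v s"
  shows "eval w A (Load_of v) s = load {..<s 2} (tail w) (head w) (s 4)
    (\<lambda>v. (if v = tail w (s 7) then 2 * s 4 else 0) + (if v = head w (s 7) then s 3 else 0))
    (A 0) (eval w A v s)"
  by (simp add: Load_of_def load_def v cong: if_cong)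

lemma sem_Rebalance:
  "sem w Rebalance \<sigma> = (fst \<sigma>, (snd \<sigma>)(0 := rebalance {..<fst \<sigma> 2} (tail w) (head w) (fst \<sigma> 4)
    (\<lambda>v. (if v = tail w (fst \<sigma> 7) then 2 * fst \<sigma> 4 else 0) + (if v = head w (fst \<sigma> 7) then fst \<sigma> 3 else 0))
    (fst \<sigma> 9) (snd \<sigma> 0)))"
proof -
  let ?e = "\<lambda>v. (if v = tail w (fst \<sigma> 7) then 2 * fst \<sigma> 4 else 0) + (if v = head w (fst \<sigma> 7) then fst \<sigma> 3 else 0)"
  let ?L = "load {..<fst \<sigma> 2} (tail w) (head w) (fst \<sigma> 4) ?e (snd \<sigma> 0)"
  let ?f = "fst \<sigma> 9"
  have T: "eval w (snd \<sigma>) (Load_of (Tail (Var 9))) (fst \<sigma>) = ?L (tail w ?f)"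
    by (subst eval_Load_of) simp_all
  have H: "eval w (snd \<sigma>) (Load_of (Head (Var 9))) (fst \<sigma>) = ?L (head w ?f)"
    by (subst eval_Load_of) simp_all
  define p q where "p = ?L (tail w ?f)" and "q = ?L (head w ?f)"
  show ?thesis
    unfolding Rebalance_def sem.simps rebalance_def p_def[symmetric] q_def[symmetric]
    using T[folded p_def] H[folded q_def] by (auto simp: Suc_le_eq fun_upd_idem)
qed

section \<open>Correctness of the program\<close>

definition constants :: "nat list \<Rightarrow> env \<Rightarrow> bool" where
  "constants w s \<longleftrightarrow> s 1 = input w 0 \<and> s 2 = input w 1 \<and> s 3 = s 1 * s 1 + s 1 * s 1 + 1 \<and>
     s 4 = s 3 + 1 \<and> s 5 = s 2 * s 4 + (s 4 + s 4) + s 3 \<and> s 6 = s 5 * s 5"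

lemma constants_upd [simp]: "6 < x \<Longrightarrow> constants w (s(x := i)) = constants w s"
  by (simp add: constants_def)

lemma constants_sizes:
  "constants w s \<Longrightarrow> s 1 = input w 0" "constants w s \<Longrightarrow> s 2 = input w 1"
  "constants w s \<Longrightarrow> s (Suc 0) = input w 0"
  by (simp_all add: constants_def)

lemma sem_Constants: "constants w (fst (sem w Constants (\<lambda>_. 0, A)))"
  by (simp add: Constants_def constants_def input_def)

context
  fixes w :: "nat list"
  assumes sparse: "sparse_graph (coded_graph w)"
begin

interpretation G: sparse_graph "coded_graph w" by (rule sparse)

abbreviation "vcount \<equiv> input w 0"
abbreviation "ecount \<equiv> input w 1"

definition hull_of :: "nat \<Rightarrow> nat set" where
  "hull_of e = G.thull {tail w e, head w e}"

lemma coded_graph_simps [simp]: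
  "verts (coded_graph w) = {..<vcount}" "edges (coded_graph w) = {..<ecount}"
  "ends (coded_graph w) e = {tail w e, head w e}"
  by (simp_all add: coded_graph_def)

lemma tail_head:
  "e < ecount \<Longrightarrow> tail w e < vcount" "e < ecount \<Longrightarrow> head w e < vcount" "e < ecount \<Longrightarrow> tail w e \<noteq> head w e"
  using G.ends_verts[of e] G.card_ends[of e] by auto

lemma hull_of_subset: "e < ecount \<Longrightarrow> hull_of e \<subseteq> {..<vcount}"
  using G.thull_edge(3)[of e] by (simp add: hull_of_def)

definition table :: "(nat \<Rightarrow> nat) \<Rightarrow> nat \<Rightarrow> bool" where
  "table T k \<longleftrightarrow> (\<forall>e<k. \<forall>v<vcount. T (e * vcount + v) \<noteq> 0 \<longleftrightarrow> v \<in> hull_of e)"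

definition balance_step :: "env \<Rightarrow> nat \<Rightarrow> (nat \<Rightarrow> nat) \<Rightarrow> nat \<Rightarrow> nat" where
  "balance_step s = rebalance {..<ecount} (tail w) (head w) (s 4)
    (\<lambda>v. (if v = tail w (s 7) then 2 * s 4 else 0) + (if v = head w (s 7) then s 3 else 0))"

lemma sem_clear:
  assumes "constants w (fst \<sigma>)" "fst \<sigma> 7 = e"
  shows "\<exists>X s. constants w s \<and> s 7 = e \<and> (\<forall>f<ecount. X f = 0) \<and>
    sem w (For 9 2 (Update 0 (Var 9) (Num 0))) \<sigma> = (s, (snd \<sigma>)(0 := X))"
proof -
  let ?I = "\<lambda>k (\<tau> :: env \<times> arrays). constants w (fst \<tau>) \<and> fst \<tau> 7 = e \<and>
    (\<exists>X. snd \<tau> = (snd \<sigma>)(0 := X) \<and> (\<forall>f<k. X f = 0))"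
  have "?I (fst \<sigma> 2) (sem w (For 9 2 (Update 0 (Var 9) (Num 0))) \<sigma>)"
  proof (rule sem_For_invariant)
    show "?I 0 \<sigma>" using assms by (auto intro!: exI[of _ "snd \<sigma> 0"])
    fix i \<tau> assume "?I i \<tau>"
    then obtain X where X: "constants w (fst \<tau>)" "fst \<tau> 7 = e" "snd \<tau> = (snd \<sigma>)(0 := X)" "\<forall>f<i. X f = 0"
      by blast
    show "?I (Suc i) (sem w (Update 0 (Var 9) (Num 0)) ((fst \<tau>)(9 := i), snd \<tau>))"
      using X by (auto simp: less_Suc_eq intro!: exI[of _ "X(i := 0)"])
  qed
  then obtain X where "snd (sem w (For 9 2 (Update 0 (Var 9) (Num 0))) \<sigma>) = (snd \<sigma>)(0 := X)"
    "\<forall>f<fst \<sigma> 2. X f = 0" "constants w (fst (sem w (For 9 2 (Update 0 (Var 9) (Num 0))) \<sigma>))"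
    "fst (sem w (For 9 2 (Update 0 (Var 9) (Num 0))) \<sigma>) 7 = e" by blast
  then show ?thesis using constants_sizes(2)[OF assms(1)]
    by (intro exI[of _ X] exI[of _ "fst (sem w (For 9 2 (Update 0 (Var 9) (Num 0))) \<sigma>)"])
      (simp add: prod_eq_iff del: sem.simps)
qed

lemma sem_sweep:
  assumes "constants w (fst \<sigma>)" "fst \<sigma> 7 = e"
  shows "\<exists>s. constants w s \<and> s 7 = e \<and>
    sem w (For 9 2 Rebalance) \<sigma> = (s, (snd \<sigma>)(0 := iterate (balance_step (fst \<sigma>)) ecount (snd \<sigma> 0)))"
proof -
  let ?I = "\<lambda>k (\<tau> :: env \<times> arrays). constants w (fst \<tau>) \<and> fst \<tau> 7 = e \<and>
    snd \<tau> = (snd \<sigma>)(0 := iterate (balance_step (fst \<sigma>)) k (snd \<sigma> 0))"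
  have "?I (fst \<sigma> 2) (sem w (For 9 2 Rebalance) \<sigma>)"
  proof (rule sem_For_invariant)
    show "?I 0 \<sigma>" using assms by simp
    fix i \<tau> assume I: "?I i \<tau>"
    then have "fst \<tau> 3 = fst \<sigma> 3" "fst \<tau> 4 = fst \<sigma> 4" "fst \<tau> 7 = fst \<sigma> 7" "fst \<tau> 2 = ecount"
      using assms by (simp_all add: constants_def)
    then show "?I (Suc i) (sem w Rebalance ((fst \<tau>)(9 := i), snd \<tau>))"
      using I by (simp add: sem_Rebalance balance_step_def cong: if_cong)
  qed
  then show ?thesis unfolding constants_sizes(2)[OF assms(1)]
    by (intro exI[of _ "fst (sem w (For 9 2 Rebalance) \<sigma>)"]) (simp add: prod_eq_iff del: sem.simps)
qed

lemma sem_sweeps: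
  assumes "constants w (fst \<sigma>)" "fst \<sigma> 7 = e"
  shows "\<exists>s. constants w s \<and> s 7 = e \<and> sem w (For 8 6 (For 9 2 Rebalance)) \<sigma>
    = (s, (snd \<sigma>)(0 := iterate (\<lambda>_. iterate (balance_step (fst \<sigma>)) ecount) (fst \<sigma> 6) (snd \<sigma> 0)))"
proof -
  let ?I = "\<lambda>k (\<tau> :: env \<times> arrays). constants w (fst \<tau>) \<and> fst \<tau> 7 = e \<and>
    snd \<tau> = (snd \<sigma>)(0 := iterate (\<lambda>_. iterate (balance_step (fst \<sigma>)) ecount) k (snd \<sigma> 0))"
  have "?I (fst \<sigma> 6) (sem w (For 8 6 (For 9 2 Rebalance)) \<sigma>)"
  proof (rule sem_For_invariant)
    show "?I 0 \<sigma>" using assms by simp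
    fix i \<tau> assume I: "?I i \<tau>"
    let ?\<tau> = "((fst \<tau>)(8 := i), snd \<tau>)"
    have "fst \<tau> 3 = fst \<sigma> 3" "fst \<tau> 4 = fst \<sigma> 4" "fst \<tau> 7 = fst \<sigma> 7"
      using I assms by (simp_all add: constants_def)
    then have "balance_step (fst ?\<tau>) = balance_step (fst \<sigma>)" by (simp add: balance_step_def cong: if_cong)
    moreover obtain s where "constants w s" "s 7 = e"
      "sem w (For 9 2 Rebalance) ?\<tau> = (s, (snd ?\<tau>)(0 := iterate (balance_step (fst ?\<tau>)) ecount (snd ?\<tau> 0)))"
      using sem_sweep[of ?\<tau> e] I by auto
    ultimately show "?I (Suc i) (sem w (For 9 2 Rebalance) ?\<tau>)" using I by simp
  qed
  then show ?thesis
    by (intro exI[of _ "fst (sem w (For 8 6 (For 9 2 Rebalance)) \<sigma>)"])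
      (simp add: prod_eq_iff del: sem.simps)
qed

lemma index_less:
  assumes "i < e" "v < k" shows "i * k + v < e * (k::nat)"
proof -
  have "i * k + v < Suc i * k" using assms by simp
  also have "\<dots> \<le> e * k" using assms by (intro mult_le_mono1) simp
  finally show ?thesis .
qed

lemma sem_Hulls:
  assumes "constants w (fst \<sigma>)"
  shows "constants w (fst (sem w Hulls \<sigma>)) \<and> table (snd (sem w Hulls \<sigma>) 1) ecount"
proof -
  let ?clear = "For 9 2 (Update 0 (Var 9) (Num 0))"
  let ?record = "Update 1 (Plus (Times 7 1) (Var 10))
          (Less (Plus (Plus (Var 4) (Var 4)) (Var 1)) (Load_of (Var 10)))"
  let ?I = "\<lambda>e (\<tau> :: env \<times> arrays). constants w (fst \<tau>) \<and> table (snd \<tau> 1) e"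
  have "?I (fst \<sigma> 2) (sem w Hulls \<sigma>)"
    unfolding Hulls_def
  proof (rule sem_For_invariant)
    show "?I 0 \<sigma>" using assms by (simp add: table_def)
    fix e \<tau> assume "e < fst \<sigma> 2" and I: "?I e \<tau>"
    then have e: "e < ecount" using constants_sizes(2)[OF assms] by simp
    let ?\<tau> = "((fst \<tau>)(7 := e), snd \<tau>)"
    obtain X s1 where 1: "constants w s1" "s1 7 = e" "\<forall>f<ecount. X f = 0"
      "sem w ?clear ?\<tau> = (s1, (snd \<tau>)(0 := X))"
      using sem_clear[of ?\<tau> e] I by auto
    let ?X = "iterate (\<lambda>_. iterate (balance_step s1) ecount) (s1 6) X"
    obtain s2 where 2: "constants w s2" "s2 7 = e"
      "sem w (For 8 6 (For 9 2 Rebalance)) (s1, (snd \<tau>)(0 := X)) = (s2, (snd \<tau>)(0 := ?X))"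
      using sem_sweeps[of "(s1, (snd \<tau>)(0 := X))" e] 1 by auto
    let ?ex = "\<lambda>v. (if v = tail w e then 2 * s1 4 else 0) + (if v = head w e then s1 3 else 0)"
    let ?L = "load {..<ecount} (tail w) (head w) (s1 4) ?ex ?X"
    have "balance_step s1 = rebalance {..<ecount} (tail w) (head w) (s1 4) ?ex"
      using 1 by (simp add: balance_step_def)
    moreover have "{v \<in> verts (coded_graph w). 2 * s1 4 + card (verts (coded_graph w)) <
        load {..<ecount} (tail w) (head w) (s1 4) ?ex
          (iterate (\<lambda>_. iterate (rebalance {..<ecount} (tail w) (head w) (s1 4) ?ex) ecount) (s1 6) X) v}
        = G.thull {tail w e, head w e}"
    proof (rule balancing_finds_thull[OF sparse])
      have q: "s1 5 = s1 2 * s1 4 + (s1 4 + s1 4) + s1 3" "s1 6 = s1 5 * s1 5"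
        "s1 3 = s1 1 * s1 1 + s1 1 * s1 1 + 1" "s1 4 = s1 3 + 1"
        using 1(1) by (simp_all only: constants_def)
      show "(ecount * s1 4 + 2 * s1 4 + s1 3)\<^sup>2 \<le> s1 6"
        unfolding q(2) q(1) constants_sizes(2)[OF 1(1)] power2_eq_square mult_2 ..
      show "2 * card (verts (coded_graph w)) * card (verts (coded_graph w)) < s1 3" "s1 3 < s1 4"
        unfolding q(4) unfolding q(3) constants_sizes(1)[OF 1(1)] by simp_all
    qed (use tail_head[OF e] 1 in simp_all)
    ultimately have hull: "v \<in> hull_of e \<longleftrightarrow> 2 * s1 4 + vcount < ?L v" if "v < vcount" for v
      using that by (auto simp: hull_of_def)
    let ?J = "\<lambda>k (\<rho> :: env \<times> arrays). constants w (fst \<rho>) \<and> fst \<rho> 7 = e \<and> snd \<rho> 0 = ?X \<and> table (snd \<rho> 1) e \<and>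
      (\<forall>v<k. snd \<rho> 1 (e * vcount + v) \<noteq> 0 \<longleftrightarrow> v \<in> hull_of e)"
    have "?J (fst (s2, (snd \<tau>)(0 := ?X)) 1) (sem w (For 10 1 ?record) (s2, (snd \<tau>)(0 := ?X)))"
    proof (rule sem_For_invariant)
      show "?J 0 (s2, (snd \<tau>)(0 := ?X))" using 2 I by simp
      fix i \<rho> assume "i < fst (s2, (snd \<tau>)(0 := ?X)) 1" and J: "?J i \<rho>"
      then have i: "i < vcount" using constants_sizes(1)[OF 2(1)] by simp
      have s: "fst \<rho> 1 = vcount" "fst \<rho> 2 = ecount" "fst \<rho> 3 = s1 3" "fst \<rho> 4 = s1 4" "fst \<rho> 7 = e"
        using J 1 by (simp_all add: constants_def)
      have L: "eval w (snd \<rho>) (Load_of (Var 10)) ((fst \<rho>)(10 := i)) = ?L i"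
        by (subst eval_Load_of) (use s J in \<open>simp_all cong: if_cong\<close>)
      have T: "snd (sem w ?record ((fst \<rho>)(10 := i), snd \<rho>)) 1
          = (snd \<rho> 1)(e * vcount + i := ?L i - (2 * s1 4 + vcount))"
        by (simp add: L s s(1)[unfolded One_nat_def] mult_2)
      have "table ((snd \<rho> 1)(e * vcount + i := ?L i - (2 * s1 4 + vcount))) e"
        using J index_less by (fastforce simp: table_def)
      moreover have "\<forall>v<Suc i. ((snd \<rho> 1)(e * vcount + i := ?L i - (2 * s1 4 + vcount))) (e * vcount + v) \<noteq> 0
          \<longleftrightarrow> v \<in> hull_of e"
        using J hull[OF i] by (auto simp: less_Suc_eq)
      moreover have "snd (sem w ?record ((fst \<rho>)(10 := i), snd \<rho>)) 0 = ?X"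
        "fst (sem w ?record ((fst \<rho>)(10 := i), snd \<rho>)) = (fst \<rho>)(10 := i)" using J by simp_all
      ultimately show "?J (Suc i) (sem w ?record ((fst \<rho>)(10 := i), snd \<rho>))"
        using J unfolding T by simp
    qed
    then have "constants w (fst (sem w (For 10 1 ?record) (s2, (snd \<tau>)(0 := ?X)))) \<and>
        table (snd (sem w (For 10 1 ?record) (s2, (snd \<tau>)(0 := ?X))) 1) (Suc e)"
      using constants_sizes(1)[OF 2(1)] by (auto simp: table_def less_Suc_eq)
    then show "?I (Suc e) (sem w (Seq ?clear (Seq (For 8 6 (For 9 2 Rebalance)) (For 10 1 ?record))) ?\<tau>)"
      unfolding sem.simps(3) 1(4) 2(3) .
  qed
  then show ?thesis unfolding constants_sizes(2)[OF assms] .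
qed

lemma holds_Member:
  assumes "table (A 1) ecount" "constants w s" "x \<noteq> 20" "s x < ecount" "eval w A v s < vcount"
  shows "holds w A (Member v x) s \<longleftrightarrow> eval w A v s \<in> hull_of (s x)"
  using assms by (simp add: Member_def table_def constants_sizes)

lemma holds_Minimal:
  assumes T: "table (A 1) ecount" and s: "constants w s" and e: "s 7 < ecount"
  shows "holds w A Minimal s \<longleftrightarrow> G.circuit (hull_of (s 7))"
proof -
  have sub: "hull_of (s 7) \<subseteq> hull_of f \<longleftrightarrow> (\<forall>v<vcount. v \<in> hull_of (s 7) \<longrightarrow> v \<in> hull_of f)" for f
    using hull_of_subset[OF e] by auto
  have "holds w A Minimal s \<longleftrightarrow> (\<forall>f<ecount. tail w f \<in> hull_of (s 7) \<and> head w f \<in> hull_of (s 7) \<longrightarrow>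
      (\<forall>v<vcount. v \<in> hull_of (s 7) \<longrightarrow> v \<in> hull_of f))"
    using s e by (simp add: Minimal_def holds_Member[of A, OF T] constants_sizes tail_head cong: conj_cong) blast
  then show ?thesis
    using G.circuit_hull_iff[of "s 7"] e sub by (simp add: hull_of_def Ball_def)
qed

lemma holds_Removable:
  assumes T: "table (A 1) ecount" and s: "constants w s" and e: "s 7 < ecount"
  shows "holds w A Removable s \<longleftrightarrow> G.removable {f. f < ecount \<and> A 2 f \<noteq> 0} (s 7)"
proof -
  have meet: "hull_of f \<inter> hull_of (s 7) \<noteq> {} \<longleftrightarrow> (\<exists>v<vcount. v \<in> hull_of f \<and> v \<in> hull_of (s 7))" for f
    using hull_of_subset[OF e] by auto
  have logic: "\<not> (\<exists>f<ecount. (P f \<and> Q f) \<and> \<not> R f) \<longleftrightarrow> (\<forall>f\<in>{f. f < ecount \<and> P f}. Q f \<longrightarrow> R f)"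
    for P Q R :: "nat \<Rightarrow> bool" by blast
  have "holds w A Removable s \<longleftrightarrow> (\<exists>v<vcount. v \<notin> hull_of (s 7) \<and>
      \<not> (\<exists>f<ecount. (A 2 f \<noteq> 0 \<and> v \<in> hull_of f) \<and> \<not> (\<exists>v<vcount. v \<in> hull_of f \<and> v \<in> hull_of (s 7))))"
    using s e by (simp add: Removable_def holds_Member[of A, OF T] constants_sizes cong: conj_cong)
  also have "\<dots> \<longleftrightarrow> (\<exists>v<vcount. v \<notin> hull_of (s 7) \<and>
      (\<forall>f\<in>{f. f < ecount \<and> A 2 f \<noteq> 0}. v \<in> hull_of f \<longrightarrow> hull_of f \<inter> hull_of (s 7) \<noteq> {}))"
    unfolding meet logic ..
  also have "\<dots> \<longleftrightarrow> G.removable {f. f < ecount \<and> A 2 f \<noteq> 0} (s 7)"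
    unfolding G.removable_def hull_of_def coded_graph_simps by (simp only: Bex_def lessThan_iff)
  finally show ?thesis .
qed

definition eliminate :: "nat \<Rightarrow> (nat \<Rightarrow> nat) \<Rightarrow> nat \<Rightarrow> nat" where
  "eliminate e X = X(e := if X e \<noteq> 0 \<and> \<not> G.removable {f. f < ecount \<and> X f \<noteq> 0} e then 1 else 0)"

text \<open>The sweeps stop at a set of edges in which none is removable, and along the way no circuit
of a decomposition is lost. Hence the final cover decides.\<close>

lemma eliminate_result:
  assumes X: "\<And>f. f < ecount \<Longrightarrow> X f = (if G.circuit (hull_of f) then 1 else 0)"
  defines "Y \<equiv> iterate (\<lambda>_. iterate eliminate ecount) ecount X"
  shows "(\<forall>v<vcount. \<exists>f<ecount. Y f \<noteq> 0 \<and> v \<in> hull_of f) \<longleftrightarrow> (\<exists>P. circuit_decomposition (coded_graph w) P)"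
proof -
  let ?I = "\<lambda>X. \<forall>f<ecount. X f \<le> 1 \<and> (X f \<noteq> 0 \<longrightarrow> G.circuit (hull_of f)) \<and>
    (\<forall>P. circuit_decomposition (coded_graph w) P \<and> hull_of f \<in> P \<longrightarrow> X f \<noteq> 0)"
  let ?phi = "\<lambda>X. \<Sum>f<ecount. X f :: nat"
  have step: "?I (eliminate e X) \<and> (eliminate e X = X \<or> ?phi (eliminate e X) < ?phi X)"
    if e: "e < ecount" and I: "?I X" for e X
  proof
    have "hull_of e \<notin> P" if "G.removable {f. f < ecount \<and> X f \<noteq> 0} e" 
      "circuit_decomposition (coded_graph w) P" for P
      using G.removable_not_in_decomposition[OF that(2) _ that(1)] I that(2) by (auto simp: hull_of_def)
    then show "?I (eliminate e X)" using I e by (auto simp: eliminate_def)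
    show "eliminate e X = X \<or> ?phi (eliminate e X) < ?phi X"
    proof (cases "eliminate e X e = X e")
      case True
      then show ?thesis by (simp add: eliminate_def fun_upd_idem_iff)
    next
      case False
      then have less: "eliminate e X e < X e" using I e by (auto simp: eliminate_def split: if_splits)
      then have "eliminate e X f \<le> X f" for f by (cases "f = e") (simp_all add: eliminate_def)
      then have "?phi (eliminate e X) < ?phi X"
        using e less by (intro sum_strict_mono_ex1) auto
      then show ?thesis ..
    qed
  qed
  have IX: "?I X"
    using X by (auto simp: G.circuit_decomposition_iff)
  have "?phi X \<le> (\<Sum>f<ecount. 1)" using X by (intro sum_mono) simp
  then have phi: "?phi X \<le> ecount" by simp
  have IY: "?I Y"
    unfolding Y_def by (rule sweeps_reach_fixpoint(1)[where \<phi> = ?phi, OF step IX phi])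
  have fixY: "eliminate f Y = Y" if "f < ecount" for f
    unfolding Y_def by (rule sweeps_reach_fixpoint(2)[where \<phi> = ?phi, OF step IX phi that])
  have stable: "\<not> G.removable {f. f < ecount \<and> Y f \<noteq> 0} e" if e: "e < ecount" "Y e \<noteq> 0" for e
    using fun_cong[OF fixY[OF e(1)], of e] e(2) by (auto simp: eliminate_def split: if_splits)
  show ?thesis
  proof
    assume "\<forall>v<vcount. \<exists>f<ecount. Y f \<noteq> 0 \<and> v \<in> hull_of f"
    then have "circuit_decomposition (coded_graph w)
        ((\<lambda>e. G.thull (ends (coded_graph w) e)) ` {f. f < ecount \<and> Y f \<noteq> 0})"
      using IY stable by (intro G.irreducible_decomposition) (auto simp: hull_of_def)
    then show "\<exists>P. circuit_decomposition (coded_graph w) P" ..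
  next
    assume "\<exists>P. circuit_decomposition (coded_graph w) P"
    then obtain P where P: "circuit_decomposition (coded_graph w) P" ..
    show "\<forall>v<vcount. \<exists>f<ecount. Y f \<noteq> 0 \<and> v \<in> hull_of f"
    proof (intro allI impI)
      fix v assume v: "v < vcount"
      have part: "partition_on {..<vcount} P" and circ: "\<And>Z. Z \<in> P \<Longrightarrow> G.circuit Z"
        using P by (auto simp: G.circuit_decomposition_iff)
      obtain Z where Z: "Z \<in> P" "v \<in> Z" using v partition_onD1[OF part] by auto
      obtain f where f: "f < ecount" "hull_of f = Z"
        using circ[OF Z(1)] G.tight_has_edge[of Z] G.circuit_eq_hull[of Z]
        by (auto simp: hull_of_def G.circuit_def)
      then show "\<exists>f<ecount. Y f \<noteq> 0 \<and> v \<in> hull_of f" using IY P Z by blast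
    qed
  qed
qed

lemma if_swap: "(if b then x else y) = (if \<not> b then y else x)"
  by simp

lemma sem_Eliminate:
  assumes "constants w (fst \<sigma>)" "table (snd \<sigma> 1) ecount"
  shows "\<exists>s A. sem w Eliminate \<sigma> = (s, A) \<and> constants w s \<and> table (A 1) ecount \<and>
    ((\<forall>v<vcount. \<exists>f<ecount. A 2 f \<noteq> 0 \<and> v \<in> hull_of f) \<longleftrightarrow> (\<exists>P. circuit_decomposition (coded_graph w) P))"
proof -
  let ?init = "Update 2 (Var 7) Minimal"
  let ?step = "Update 2 (Var 7) (Conj (Arr 2 (Var 7)) (Neg Removable))"
  let ?C = "\<lambda>(\<tau> :: env \<times> arrays). constants w (fst \<tau>) \<and> table (snd \<tau> 1) ecount"
  let ?I = "\<lambda>k (\<tau> :: env \<times> arrays). ?C \<tau> \<and> (\<forall>f<k. snd \<tau> 2 f = (if G.circuit (hull_of f) then 1 else 0))"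
  have 1: "?I (fst \<sigma> 2) (sem w (For 7 2 ?init) \<sigma>)"
  proof (rule sem_For_invariant)
    show "?I 0 \<sigma>" using assms by simp
    fix i \<tau> assume "i < fst \<sigma> 2" and I: "?I i \<tau>"
    then have i: "i < ecount" using constants_sizes(2)[OF assms(1)] by simp
    let ?s = "(fst \<tau>)(7 := i)"
    have "holds w (snd \<tau>) Minimal ?s \<longleftrightarrow> G.circuit (hull_of i)"
      using holds_Minimal[of "snd \<tau>" ?s] I i by simp
    moreover have "eval w (snd \<tau>) Minimal ?s = (if holds w (snd \<tau>) Minimal ?s then 1 else 0)"
      unfolding Minimal_def eval_Neg holds_simps(2) by (rule if_swap)
    ultimately show "?I (Suc i) (sem w ?init (?s, snd \<tau>))"
      using I by (simp add: less_Suc_eq)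
  qed
  define \<sigma>1 where "\<sigma>1 = sem w (For 7 2 ?init) \<sigma>"
  have 1: "?C \<sigma>1" "\<And>f. f < ecount \<Longrightarrow> snd \<sigma>1 2 f = (if G.circuit (hull_of f) then 1 else 0)"
    using 1 unfolding constants_sizes(2)[OF assms(1)] \<sigma>1_def by blast+
  have sweep: "?C (sem w (For 7 2 ?step) \<tau>) \<and>
      snd (sem w (For 7 2 ?step) \<tau>) 2 = iterate eliminate ecount (snd \<tau> 2)" if \<tau>: "?C \<tau>" for \<tau>
  proof -
    let ?J = "\<lambda>k (\<rho> :: env \<times> arrays). ?C \<rho> \<and> snd \<rho> 2 = iterate eliminate k (snd \<tau> 2)"
    have "?J (fst \<tau> 2) (sem w (For 7 2 ?step) \<tau>)"
    proof (rule sem_For_invariant)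
      show "?J 0 \<tau>" using \<tau> by simp
      fix i \<rho> assume "i < fst \<tau> 2" and J: "?J i \<rho>"
      then have i: "i < ecount" using constants_sizes(2)[OF conjunct1[OF \<tau>]] by simp
      let ?s = "(fst \<rho>)(7 := i)"
      have "holds w (snd \<rho>) Removable ?s \<longleftrightarrow> G.removable {f. f < ecount \<and> snd \<rho> 2 f \<noteq> 0} i"
        using holds_Removable[of "snd \<rho>" ?s] J i by simp
      then show "?J (Suc i) (sem w ?step (?s, snd \<rho>))"
        using J by (simp add: eliminate_def eval_Conj eval_Neg)
    qed
    then show ?thesis unfolding constants_sizes(2)[OF conjunct1[OF \<tau>]] .
  qed
  let ?K = "\<lambda>k (\<tau> :: env \<times> arrays). ?C \<tau> \<and> snd \<tau> 2 = iterate (\<lambda>_. iterate eliminate ecount) k (snd \<sigma>1 2)"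
  have "?K (fst \<sigma>1 2) (sem w (For 8 2 (For 7 2 ?step)) \<sigma>1)"
  proof (rule sem_For_invariant)
    show "?K 0 \<sigma>1" using 1 by simp
    fix i \<tau> assume K: "?K i \<tau>"
    then show "?K (Suc i) (sem w (For 7 2 ?step) ((fst \<tau>)(8 := i), snd \<tau>))"
      using sweep[of "((fst \<tau>)(8 := i), snd \<tau>)"] by simp
  qed
  moreover have "fst \<sigma>1 2 = ecount" using 1 constants_sizes by blast
  moreover have "sem w Eliminate \<sigma> = sem w (For 8 2 (For 7 2 ?step)) \<sigma>1"
    unfolding Eliminate_def \<sigma>1_def by (rule sem.simps(3))
  ultimately have K: "?K ecount (sem w Eliminate \<sigma>)" by simp
  then show ?thesis using eliminate_result[OF 1(2)]
    by (intro exI[of _ "fst (sem w Eliminate \<sigma>)"] exI[of _ "snd (sem w Eliminate \<sigma>)"]) simp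
qed

lemma sem_Decide:
  "fst (sem w Decide (\<lambda>_. 0, \<lambda>_ _. 0)) 0 \<noteq> 0 \<longleftrightarrow> (\<exists>P. circuit_decomposition (coded_graph w) P)"
proof -
  let ?\<sigma> = "sem w Hulls (sem w Constants (\<lambda>_. 0, \<lambda>_ _. 0))"
  obtain s A where 1: "sem w Eliminate ?\<sigma> = (s, A)" "constants w s" "table (A 1) ecount"
    "(\<forall>v<vcount. \<exists>f<ecount. A 2 f \<noteq> 0 \<and> v \<in> hull_of f) \<longleftrightarrow> (\<exists>P. circuit_decomposition (coded_graph w) P)"
    using sem_Eliminate[of ?\<sigma>] sem_Hulls[OF sem_Constants] by blast
  have "sem w Decide (\<lambda>_. 0, \<lambda>_ _. 0) = sem w Answer (s, A)"
    unfolding Decide_def sem.simps(3) 1(1) ..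
  moreover have "fst (sem w Answer (s, A)) 0 \<noteq> 0 \<longleftrightarrow> (\<forall>v<vcount. \<exists>f<ecount. A 2 f \<noteq> 0 \<and> v \<in> hull_of f)"
    using 1(2) by (simp add: Answer_def eval_Neg constants_sizes holds_Member[of A, OF 1(3)] cong: conj_cong)
  ultimately show ?thesis using 1(4) by simp
qed

end

section \<open>Polynomial running time\<close>

text \<open>The largest variable is the number of sweeps, a polynomial in the number of vertices and
edges. Adding up the bounds on all variables saves comparing them.\<close>

definition size_bound :: "nat poly" where
  "size_bound = (let N = [:0, 1:]; D = N * N + N * N + [:1:]; M = D + [:1:]; t = N * M + (M + M) + D
     in t * t + t + M + D + N + [:1:])"

text \<open>Before the answer is stored at the very end, only the computation of the constants assigns
to variables, and it assigns each of them once, so their final values bound them throughout.\<close>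

lemma Decide_bounded_run:
  assumes N: "input w 0 + input w 1 = N"
  shows "bounded_run w (poly size_bound N) Decide (\<lambda>_. 0, \<lambda>_ _. 0)"
proof -
  let ?B = "poly size_bound N"
  let ?s = "fst (sem w Constants (\<lambda>_. 0, \<lambda>_ _. 0))"
  define D M t where "D = N * N + N * N + 1" and "M = D + 1" and "t = N * M + (M + M) + D"
  have B: "?B = t * t + t + M + D + N + 1"
    unfolding size_bound_def Let_def D_def M_def t_def poly_add poly_mult
    by (simp only: poly_pCons poly_0 mult_zero_right mult_1_right add_0_right add_0)
  have c: "constants w ?s" by (rule sem_Constants)
  have q: "?s 1 = input w 0" "?s 2 = input w 1" "?s 3 = ?s 1 * ?s 1 + ?s 1 * ?s 1 + 1"
    "?s 4 = ?s 3 + 1" "?s 5 = ?s 2 * ?s 4 + (?s 4 + ?s 4) + ?s 3" "?s 6 = ?s 5 * ?s 5"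
    using c by (simp_all only: constants_def)
  have 1: "?s 1 \<le> N" "?s 2 \<le> N" unfolding q(1,2) using N by simp_all
  have 3: "?s 3 \<le> D" unfolding q(3) D_def by (intro add_mono mult_le_mono 1 order.refl)
  have 4: "?s 4 \<le> M" unfolding q(4) M_def by (intro add_mono 3 order.refl)
  have 5: "?s 5 \<le> t" unfolding q(5) t_def by (intro add_mono mult_le_mono 1 3 4)
  have 6: "?s 6 \<le> t * t" unfolding q(6) by (intro mult_le_mono 5)
  have s: "?s 1 \<le> ?B" "?s 2 \<le> ?B" "?s 3 \<le> ?B" "?s 4 \<le> ?B" "?s 5 \<le> ?B" "?s 6 \<le> ?B"
    unfolding B using 1 3 4 5 6 by linarith+
  have "?s x = 0" if "x \<notin> {1, 2, 3, 4, 5, 6}" for x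
    using that by (simp add: Constants_def)
  then have s_all: "?s x \<le> ?B" for x using s by (cases "x \<in> {1, 2, 3, 4, 5, 6}") auto
  define v3 v4 v5 v6 where "v3 = ?s 3" and "v4 = ?s 4" and "v5 = ?s 5" and "v6 = ?s 6"
  note v = q(3)[folded v3_def, unfolded q(1)] q(4)[folded v3_def v4_def]
    q(5)[folded v3_def v4_def v5_def, unfolded q(2)] q(6)[folded v5_def v6_def]
  have run: "sem w (Assign 1 (Inp (Num 0))) (r, A) = (r(1 := input w 0), A)"
    "sem w (Assign 2 (Inp (Num 1))) (r, A) = (r(2 := input w 1), A)"
    "r 1 = input w 0 \<Longrightarrow>
      sem w (Assign 3 (Plus (Plus (Times 1 1) (Times 1 1)) (Num 1))) (r, A) = (r(3 := v3), A)"
    "r 3 = v3 \<Longrightarrow> sem w (Assign 4 (Plus (Var 3) (Num 1))) (r, A) = (r(4 := v4), A)"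
    "r 2 = input w 1 \<Longrightarrow> r 3 = v3 \<Longrightarrow> r 4 = v4 \<Longrightarrow>
      sem w (Assign 5 (Plus (Plus (Times 2 4) (Plus (Var 4) (Var 4))) (Var 3))) (r, A) = (r(5 := v5), A)"
    for r A by (simp_all add: v input_def)
  have "bounded_run w ?B Constants (\<lambda>_. 0, \<lambda>_ _. 0)"
    using s[folded v3_def v4_def v5_def v6_def, unfolded q(1,2)]
    by (simp add: Constants_def run del: sem.simps(1) One_nat_def)
  moreover have "bounded_run w ?B (Seq Hulls Eliminate) (sem w Constants (\<lambda>_. 0, \<lambda>_ _. 0)) \<and>
      (\<forall>z. fst (sem w (Seq Hulls Eliminate) (sem w Constants (\<lambda>_. 0, \<lambda>_ _. 0))) z \<le> ?B)"
    using s_all by (intro assign_free_bounded_run) (simp_all add: Hulls_def Eliminate_def Rebalance_def)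
  ultimately show ?thesis by (simp add: Decide_def Answer_def)
qed

lemma Decide_arrays: "com_arrays Decide \<subseteq> {..<4}"
  by (simp add: Decide_def Constants_def Hulls_def Eliminate_def Answer_def
      Rebalance_def Load_of_def Minimal_def Removable_def Member_def Conj_def Neg_def Equal_def
      Less_def Times_def Tail_def Head_def)

theorem theorem4p8:
  shows "(\<exists>(M :: instr list) (p :: nat poly). \<forall>(G :: (nat, nat) mgraph) w.
            two_tree_graph G \<and> graph_code G w \<longrightarrow>
            ram_decides M w (poly p (card (verts G) + card (edges G)))
              (\<exists>P. circuit_decomposition G P))
       \<and> (\<forall>G :: ('v, 'e) mgraph. two_tree_graph G \<longrightarrow>
            (\<exists>P. circuit_decomposition G P) \<longrightarrow> (\<exists>!P. circuit_decomposition G P))"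
proof (intro conjI exI allI impI)
  fix G :: "(nat, nat) mgraph" and w :: "nat list"
  assume "two_tree_graph G \<and> graph_code G w"
  then have G: "sparse_graph G" and code: "graph_code G w" using two_tree_sparse by auto
  let ?N = "card (verts G) + card (edges G)"
  have N: "input w 0 + input w 1 = ?N" using coded_graph_iso(2,3)[OF code] by simp
  show "ram_decides (compile Decide) w (poly (pcompose (com_time Decide) size_bound) ?N)
      (\<exists>P. circuit_decomposition G P)"
  proof (rule compile_decides[OF Decide_arrays Decide_bounded_run[OF N]])
    show "poly (com_time Decide) (poly size_bound ?N) \<le> poly (pcompose (com_time Decide) size_bound) ?N"
      unfolding poly_pcompose ..
    show "fst (sem w Decide (\<lambda>_. 0, \<lambda>_ _. 0)) 0 \<noteq> 0 \<longleftrightarrow> (\<exists>P. circuit_decomposition G P)"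
      unfolding sem_Decide[OF coded_graph_decomposition(1)[OF G code]]
      by (rule coded_graph_decomposition(2)[OF G code])
  qed
next
  fix G :: "('v, 'e) mgraph"
  assume "two_tree_graph G" "\<exists>P. circuit_decomposition G P"
  then show "\<exists>!P. circuit_decomposition G P" using two_tree_decomposition_unique by blast
qed

end
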